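(* Let $\vec{\mathbb{T}}=(\mathbb{V},\vec{\mathbb{E}})$ be a directed tree in which each vertex has exactly one parent and at least one child, let $\phi$ be a flow on $\vec{\mathbb{T}}$, and let $\mu_\phi$ be the associated flow measure. Then $\mu_\phi$ is localised if and only if $$\sum_{y\in A(x)}e^{-\phi_{yp(y)}}<\infty$$ for some $x\in\mathbb{V}$, where $A(x)\subset\mathbb{V}$ denotes the set of ancestors of $x$ and $p(y)$ denotes the parent of $y$.
   Context: $xy\in\vec{\mathbb{E}}$ means that $x$ is the child and $y=p(x)$ is the parent. A monotone function is $h:\mathbb{V}\to\mathbb{Z}$ with $h(y)-h(x)\ge 0$ for all $xy\in\vec{\mathbb{E}}$; the set of these is $\operatorname{Mon}(\vec{\mathbb{T}},\mathbb{Z})$. Let $\Omega=\mathbb{Z}^{\mathbb{V}}$ with product sigma-algebra $\mathcal{F}$, and let $\mathcal{F}^\nabla\subset\mathcal{F}$ be the sigma-algebra generated by all height differences $h(y)-h(z)$, $y,z\in\mathbb{V}$. Specification: for every finite $\Lambda\subset\mathbb{V}$ and $b\in\operatorname{Mon}(\vec{\mathbb{T}},\mathbb{Z})$, $\gamma_\Lambda(\cdot,b)$ is the uniform probability measure on the finite set $\{h\in\operatorname{Mon}(\vec{\mathbb{T}},\mathbb{Z}): h|_{\mathbb{V}\setminus\Lambda}=b|_{\mathbb{V}\setminus\Lambda}\}$. A Gibbs measure (resp. gradient Gibbs measure) is a probability measure $\mu$ on $(\Omega,\mathcal{F})$ (resp. on $(\Omega,\mathcal{F}^\nabla)$) that is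 supported on $\operatorname{Mon}(\vec{\mathbb{T}},\mathbb{Z})$ and satisfies $\mu\gamma_\Lambda=\mu$ for every finite $\Lambda\subset\mathbb{V}$, where $\mu\gamma_\Lambda(A)=\int\gamma_\Lambda(A,b)\,d\mu(b)$. A gradient Gibbs measure is extremal if it is trivial on $\mathcal{T}\cap\mathcal{F}^\nabla$, where $\mathcal{T}=\bigcap_\Lambda\sigma(h(y):y\in\mathbb{V}\setminus\Lambda)$ (over finite $\Lambda$). A flow on $\vec{\mathbb{T}}$ is a map $\phi:\vec{\mathbb{E}}\to(0,\infty]$ such that $\phi_{xp(x)}=\sum_{y:\,yx\in\vec{\mathbb{E}}}\phi_{yx}$ for all $x\in\mathbb{V}$. For $\alpha\in(0,\infty]$, $\operatorname{Geom}(\alpha)$ is the distribution on $\mathbb{Z}_{\ge0}$ for which the probability of $k$ is proportional to $e^{-k\alpha}$ (for $\alpha=\infty$: the Dirac mass at $0$). The flow measure $\mu_\phi$ is the probability measure on $(\Omega,\mathcal{F}^\nabla)$ under which $(h(y)-h(x))_{xy\in\vec{\mathbb{E}}}$ are independent with $h(y)-h(x)\sim\operatorname{Geom}(\phi_{xy})$; it is an extremal gradient Gibbs measure. An extremal gradient Gibbs measure is called localised if it is the restriction to $\mathcal{F}^\nabla$ of some Gibbs measure (on $(\Omega,\mathcal{F})$), and delocalised otherwise. Convention: $e^{-\infty}=0$. *)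

theory Defs
  imports "HOL-Probability.Probability"
begin

text \<open>
  The vertex set of the tree is the whole type \<open>'v\<close>, which is of class \<open>countable\<close> wherever
  measures appear (otherwise the monotone functions need not be measurable). Vertices may have
  infinitely many children. A pair \<open>(x, y) \<in> E\<close> means that \<open>y\<close> is the parent of \<open>x\<close>.
\<close>

definition undirected_cycle :: "'v rel \<Rightarrow> 'v list \<Rightarrow> bool" where
  "undirected_cycle E vs \<longleftrightarrow>
     3 \<le> length vs \<and> distinct vs \<and>
     successively (\<lambda>u v. (u, v) \<in> E \<union> E\<inverse>) vs \<and> (last vs, hd vs) \<in> E \<union> E\<inverse>"

text \<open>
  The first three conditions say that forgetting the orientation gives a tree: \<open>asym\<close> excludes
  loops and edges carrying both orientations.
\<close>

definition directed_tree :: "'v rel \<Rightarrow> bool" where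
  "directed_tree E \<longleftrightarrow>
     asym E \<and>
     (\<forall>x y. (x, y) \<in> (E \<union> E\<inverse>)\<^sup>*) \<and>
     (\<nexists>vs. undirected_cycle E vs) \<and>
     (\<forall>x. \<exists>!y. (x, y) \<in> E) \<and>
     (\<forall>x. \<exists>y. (y, x) \<in> E)"

definition parent :: "'v rel \<Rightarrow> 'v \<Rightarrow> 'v" where
  "parent E x = (THE y. (x, y) \<in> E)"

definition ancestors :: "'v rel \<Rightarrow> 'v \<Rightarrow> 'v set" where
  "ancestors E x = {y. (x, y) \<in> E\<^sup>+}"

definition Mon :: "'v rel \<Rightarrow> ('v \<Rightarrow> int) set" where
  "Mon E = {h. \<forall>(x, y) \<in> E. h y - h x \<ge> 0}"


definition height_space :: "('v \<Rightarrow> int) measure" where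
  "height_space = PiM UNIV (\<lambda>_. count_space UNIV)"

definition gradient_space :: "('v \<Rightarrow> int) measure" where
  "gradient_space = sigma UNIV {{h. h y - h z \<in> B} |y z B. True}"

definition monotone_extensions :: "'v rel \<Rightarrow> 'v set \<Rightarrow> ('v \<Rightarrow> int) \<Rightarrow> ('v \<Rightarrow> int) set" where
  "monotone_extensions E \<Lambda> b = {h \<in> Mon E. \<forall>v. v \<notin> \<Lambda> \<longrightarrow> h v = b v}"

text \<open>
  Only used for finite \<open>\<Lambda>\<close> and \<open>b \<in> Mon E\<close>, when the set of extensions is finite and nonempty.
\<close>

definition spec :: "'v rel \<Rightarrow> 'v set \<Rightarrow> ('v \<Rightarrow> int) \<Rightarrow> ('v \<Rightarrow> int) measure" where
  "spec E \<Lambda> b = measure_pmf (pmf_of_set (monotone_extensions E \<Lambda> b))"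

definition gibbs_measure :: "'v::countable rel \<Rightarrow> ('v \<Rightarrow> int) measure \<Rightarrow> bool" where
  "gibbs_measure E \<mu> \<longleftrightarrow>
     prob_space \<mu> \<and> sets \<mu> = sets height_space \<and>
     (AE h in \<mu>. h \<in> Mon E) \<and>
     (\<forall>\<Lambda>. finite \<Lambda> \<longrightarrow> (\<forall>A \<in> sets height_space.
        (\<integral>\<^sup>+ b \<in> Mon E. emeasure (spec E \<Lambda> b) A \<partial>\<mu>) = emeasure \<mu> A))"

text \<open>
  The adjective ``localised'' is meant for extremal gradient Gibbs measures \<open>\<mu>\<close>; every flow
  measure is one.
\<close>

definition localised :: "'v::countable rel \<Rightarrow> ('v \<Rightarrow> int) measure \<Rightarrow> bool" where
  "localised E \<mu> \<longleftrightarrow> (\<exists>\<nu>. gibbs_measure E \<nu> \<and> restr_to_subalg \<nu> gradient_space = \<mu>)"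


definition flow :: "'v rel \<Rightarrow> ('v \<times> 'v \<Rightarrow> ennreal) \<Rightarrow> bool" where
  "flow E \<phi> \<longleftrightarrow>
     (\<forall>e \<in> E. 0 < \<phi> e) \<and>
     (\<forall>x. \<phi> (x, parent E x) = (\<Sum>\<^sub>\<infinity>y | (y, x) \<in> E. \<phi> (y, x)))"

definition exp_neg :: "ennreal \<Rightarrow> real" where
  "exp_neg a = (if a = \<infinity> then 0 else exp (- enn2real a))"

definition Geom :: "ennreal \<Rightarrow> nat pmf" where
  "Geom \<alpha> = geometric_pmf (1 - exp_neg \<alpha>)"

text \<open>
  The probability of \<open>k\<close> is proportional to \<open>e\<^sup>-\<^sup>k\<^sup>\<alpha>\<close>. For \<open>\<alpha> = \<infinity>\<close> this is the Dirac mass at \<open>0\<close>,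
  as \<open>0 * \<infinity> = 0\<close> in \<^typ>\<open>ennreal\<close>.
\<close>

lemma pmf_Geom:
  assumes "0 < \<alpha>"
  shows "pmf (Geom \<alpha>) k = (1 - exp_neg \<alpha>) * exp_neg (of_nat k * \<alpha>)"
proof (cases "\<alpha> = \<infinity>")
  case True
  then show ?thesis
    by (cases "k = 0") (auto simp: Geom_def exp_neg_def ennreal_mult_top)
next
  case False
  then obtain a where a: "\<alpha> = ennreal a" "0 \<le> a" by (cases \<alpha>) auto
  with assms have "0 < a" by (simp add: ennreal_less_zero_iff)
  moreover have "of_nat k * \<alpha> = ennreal (real k * a)"
    using a by (simp add: ennreal_of_nat_eq_real_of_nat ennreal_mult)
  ultimately show ?thesis
    using a by (simp add: Geom_def exp_neg_def exp_of_nat_mult[symmetric])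
qed

definition flow_measure ::
  "'v::countable rel \<Rightarrow> ('v \<times> 'v \<Rightarrow> ennreal) \<Rightarrow> ('v \<Rightarrow> int) measure \<Rightarrow> bool" where
  "flow_measure E \<phi> \<mu> \<longleftrightarrow>
     prob_space \<mu> \<and> sets \<mu> = sets gradient_space \<and>
     prob_space.indep_vars \<mu> (\<lambda>_. count_space UNIV) (\<lambda>(x, y) h. h y - h x) E \<and>
     (\<forall>(x, y) \<in> E.
        distr \<mu> (count_space UNIV) (\<lambda>h. h y - h x) = measure_pmf (map_pmf int (Geom (\<phi> (x, y)))))"

end

theory Submission
  imports Defs
begin

text \<open>
  The Gibbs property says that a measure is preserved by \<open>h \<mapsto> h + f\<close>, for finitely supported \<open>f\<close>,
  wherever both \<open>h\<close> and \<open>h + f\<close> are monotone. Raising the single vertex \<open>v\<close> by one lowers the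
  gradient towards the parent and raises those towards the children, so the flow condition at \<open>v\<close>
  makes \<open>\<mu>\<close> invariant under this move, and general \<open>f\<close> are compositions of such moves.

  If the sum over the ancestors of \<open>x\<close> converges, Borel--Cantelli shows that the height is
  almost surely constant far up the ancestral line of \<open>x\<close>. Subtracting this limit, which no finitely
  supported move affects, turns \<open>\<mu>\<close> into a Gibbs measure.

  Conversely, let \<open>\<nu>\<close> be a Gibbs measure restricting to \<open>\<mu>\<close>, and let \<open>y\<^sub>j\<close> be the \<open>j\<close>-th
  ancestor of \<open>x\<close>. Raising by one a finite set \<open>S\<^sub>j\<close> that contains \<open>x\<close> and has top vertex \<open>y\<^sub>j\<close> maps
  the event that the gradient above \<open>y\<^sub>j\<close> is positive to the event \<open>R\<^sub>j\<close> that all gradients at the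
  lower boundary of \<open>S\<^sub>j\<close> are positive. Both have probability \<open>q\<^sub>j\<close>, the \<open>j\<close>-th term of the sum.
  For suitable \<open>S\<^sub>j\<close> both families of events are almost pairwise independent; if the sum diverges,
  the number of events that occur concentrates around its mean, and summing over \<open>j\<close> gives
  \<open>\<nu>(h x = a - 1) = \<nu>(h x = a)\<close> for all \<open>a\<close>. No probability distribution on the integers
  satisfies this.
\<close>

section \<open>Trees in which every vertex has one parent\<close>

locale rooted_up_tree =
  fixes E :: "'v rel"
  assumes tree: "directed_tree E"
begin

abbreviation p :: "'v \<Rightarrow> 'v" where "p \<equiv> parent E"

lemma edge_iff: "(x, y) \<in> E \<longleftrightarrow> y = p x"
proof -
  have "\<exists>!y. (x, y) \<in> E" using tree by (simp add: directed_tree_def)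
  from theI'[OF this] this show ?thesis unfolding parent_def by metis
qed

text \<open>With \<open>m\<close> the least return time, the first \<open>m\<close> iterates form an
  undirected cycle if \<open>m\<close> is at least 3. The values 1 and 2 give no cycle in the sense
  of \<open>undirected_cycle\<close> and contradict \<open>asym E\<close> instead.\<close>

lemma funpow_parent_neq:
  assumes "0 < n"
  shows "(p ^^ n) x \<noteq> x"
proof
  assume *: "(p ^^ n) x = x"
  define m where "m = (LEAST m. 0 < m \<and> (p ^^ m) x = x)"
  have m: "0 < m" "(p ^^ m) x = x"
    using LeastI[of "\<lambda>m. 0 < m \<and> (p ^^ m) x = x", OF conjI[OF assms *]] by (auto simp: m_def)
  have least: "(p ^^ k) x \<noteq> x" if "0 < k" "k < m" for k
    using that not_less_Least[of k "\<lambda>m. 0 < m \<and> (p ^^ m) x = x"] by (auto simp: m_def)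
  have asym: "(u, v) \<in> E \<Longrightarrow> (v, u) \<notin> E" for u v
    using tree by (auto simp: directed_tree_def asym_iff)
  have "m \<noteq> 1" using m asym[of x x] by (auto simp: edge_iff)
  moreover have "m \<noteq> 2"
    using m asym[of x "p x"] by (auto simp: edge_iff numeral_2_eq_2)
  ultimately have m3: "3 \<le> m" using m by linarith
  define vs where "vs = map (\<lambda>i. (p ^^ i) x) [0..<m]"
  have inj: "(p ^^ i) x \<noteq> (p ^^ j) x" if "i < j" "j < m" for i j
  proof
    assume eq: "(p ^^ i) x = (p ^^ j) x"
    \<comment> \<open>Equal iterates at \<open>i < j < m\<close> give the return time
      \<open>m - j + i\<close>, which is positive and smaller than \<open>m\<close>.\<close>
    have "(p ^^ (m - j + i)) x = (p ^^ (m - j)) ((p ^^ j) x)"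
      by (simp add: funpow_add eq)
    also have "\<dots> = (p ^^ (m - j + j)) x"
      unfolding funpow_add by simp
    also have "\<dots> = x" using m that by simp
    finally show False using least[of "m - j + i"] that m by linarith
  qed
  have "distinct vs"
    unfolding vs_def distinct_map by (auto intro!: inj_onI dest: inj) (metis inj nat_neq_iff)
  moreover have "successively (\<lambda>u v. (u, v) \<in> E \<union> E\<inverse>) vs"
    unfolding successively_conv_nth by (auto simp: vs_def edge_iff)
  moreover have "(last vs, hd vs) \<in> E \<union> E\<inverse>"
  proof -
    have "p ((p ^^ (m - 1)) x) = (p ^^ m) x"
      using m by (metis Suc_diff_1 comp_apply funpow.simps(2))
    then show ?thesis using m m3 by (simp add: vs_def edge_iff last_map hd_map)
  qed
  ultimately have "undirected_cycle E vs"
    using m3 by (simp add: undirected_cycle_def vs_def)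
  then show False using tree by (auto simp: directed_tree_def)
qed

lemma funpow_parent_eq_iff: "(p ^^ i) x = (p ^^ j) x \<longleftrightarrow> i = j"
proof -
  have aux: "(p ^^ i) x \<noteq> (p ^^ j) x" if "i < j" for i j
  proof -
    have "(p ^^ j) x = (p ^^ (j - i)) ((p ^^ i) x)"
      using that by (metis comp_apply funpow_add le_add_diff_inverse2 less_imp_le)
    then show ?thesis using funpow_parent_neq[of "j - i" "(p ^^ i) x"] that by auto
  qed
  show ?thesis by (metis aux nat_neq_iff)
qed

lemma inj_funpow_parent: "inj (\<lambda>n. (p ^^ n) x)"
  by (auto intro!: injI simp: funpow_parent_eq_iff)

lemma parent_neq: "p x \<noteq> x"
  using funpow_parent_neq[of 1 x] by simp

lemma ancestors_eq: "ancestors E x = range (\<lambda>n. (p ^^ Suc n) x)"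
proof -
  have "(x, y) \<in> E\<^sup>+ \<longleftrightarrow> (\<exists>n. y = (p ^^ Suc n) x)" for y
  proof
    assume "(x, y) \<in> E\<^sup>+"
    then show "\<exists>n. y = (p ^^ Suc n) x"
    proof induction
      case (base y)
      then show ?case by (intro exI[of _ 0]) (simp add: edge_iff)
    next
      case (step y z)
      then obtain n where "y = (p ^^ Suc n) x" by blast
      then show ?case using step by (intro exI[of _ "Suc n"]) (simp add: edge_iff)
    qed
  next
    assume "\<exists>n. y = (p ^^ Suc n) x"
    then obtain n where y: "y = (p ^^ Suc n) x" ..
    have "(x, (p ^^ Suc n) x) \<in> E\<^sup>+"
    proof (induction n)
      case (Suc n)
      have "((p ^^ Suc n) x, (p ^^ Suc (Suc n)) x) \<in> E" by (simp add: edge_iff)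
      with Suc show ?case by (rule trancl_into_trancl)
    qed (auto simp: edge_iff)
    with y show "(x, y) \<in> E\<^sup>+" by simp
  qed
  then show ?thesis by (auto simp: ancestors_def)
qed

text \<open>By induction along an undirected path from \<open>x\<close>: a step up adds an iterate
  on the \<open>x\<close> side, a step down one on the other side. This reduces height differences
  to gradients along ancestral lines.\<close>

lemma common_ancestor: "\<exists>m n. (p ^^ m) x = (p ^^ n) y"
proof -
  have "(x, y) \<in> (E \<union> E\<inverse>)\<^sup>*" using tree by (simp add: directed_tree_def)
  then show ?thesis
  proof induction
    case base
    show ?case by (intro exI[of _ 0]) simp
  next
    case (step y z)
    then obtain m n where mn: "(p ^^ m) x = (p ^^ n) y" by blast
    from step(2) consider "z = p y" | "y = p z" by (auto simp: edge_iff)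
    then show ?case
    proof cases
      case 1
      have "(p ^^ Suc m) x = (p ^^ n) z"
        using mn 1 by (simp add: funpow_swap1)
      then show ?thesis by blast
    next
      case 2
      then have "(p ^^ m) x = (p ^^ Suc n) z" using mn by (simp add: funpow_swap1)
      then show ?thesis by blast
    qed
  qed
qed

lemma ancestor_outside:
  assumes "finite L"
  obtains n where "(p ^^ n) v \<notin> L"
proof -
  have "infinite (range (\<lambda>n. (p ^^ n) v))"
    using inj_funpow_parent by (simp add: finite_image_iff)
  then have "\<not> range (\<lambda>n. (p ^^ n) v) \<subseteq> L"
    using assms finite_subset by blast
  with that show thesis by blast
qed

text \<open>A choice \<open>c\<close> of one child per vertex is a right inverse of
  \<open>p\<close>, so its orbits are injective and leave every finite set.\<close>

lemma descendant_outside: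
  assumes "finite L"
  obtains n w where "(p ^^ n) w = v" "w \<notin> L"
proof -
  have "\<exists>y. p y = x" for x using tree unfolding directed_tree_def edge_iff by metis
  then obtain c where c: "\<And>x. p (c x) = x" by metis
  have pc: "(p ^^ n) ((c ^^ n) v) = v" for n
    by (induction n) (simp_all add: funpow_swap1[of p] c)
  have "inj (\<lambda>n. (c ^^ n) v)"
  proof -
    have "(c ^^ i) v \<noteq> (c ^^ j) v" if "i < j" for i j
    proof
      assume eq: "(c ^^ i) v = (c ^^ j) v"
      have "v = (p ^^ j) ((c ^^ i) v)" using pc[of j] eq by simp
      also have "\<dots> = (p ^^ (j - i)) ((p ^^ i) ((c ^^ i) v))"
        using that by (metis comp_apply funpow_add le_add_diff_inverse2 less_imp_le)
      finally show False using funpow_parent_neq[of "j - i" v] that pc[of i] by auto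
    qed
    then show ?thesis by (metis (mono_tags, lifting) injI nat_neq_iff)
  qed
  then have "infinite (range (\<lambda>n. (c ^^ n) v))" by (simp add: finite_image_iff)
  then have "\<not> range (\<lambda>n. (c ^^ n) v) \<subseteq> L"
    using assms finite_subset by blast
  then obtain n where "(c ^^ n) v \<notin> L" by blast
  with that pc show thesis by blast
qed

section \<open>Gradients, and finiteness of the sets of monotone extensions\<close>

definition grad :: "'v \<Rightarrow> ('v \<Rightarrow> int) \<Rightarrow> int" where
  "grad v h = h (p v) - h v"

lemma Mon_iff: "h \<in> Mon E \<longleftrightarrow> (\<forall>v. 0 \<le> grad v h)"
  by (auto simp: Mon_def edge_iff grad_def)

lemma Mon_funpow: "h \<in> Mon E \<Longrightarrow> h v \<le> h ((p ^^ n) v)"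
proof (induction n)
  case (Suc n)
  have "h ((p ^^ n) v) \<le> h ((p ^^ Suc n) v)"
    using Suc.prems by (auto simp: Mon_iff grad_def)
  with Suc show ?case by simp
qed simp

lemma grad_add: "grad v (\<lambda>u. h u + f u) = grad v h + grad v f"
  by (simp add: grad_def)

lemma grad_indicator: "grad v (indicator S) = of_bool (p v \<in> S) - of_bool (v \<in> S)"
  by (simp add: grad_def indicator_def)

lemma self_in_extensions: "b \<in> Mon E \<Longrightarrow> b \<in> monotone_extensions E L b"
  by (simp add: monotone_extensions_def)

text \<open>Monotonicity squeezes \<open>h v\<close> between the values of \<open>b\<close> at a
  descendant and at an ancestor of \<open>v\<close> outside \<open>L\<close>, where \<open>h\<close>
  and \<open>b\<close> agree.\<close>

lemma finite_extensions:
  assumes "finite L"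
  shows "finite (monotone_extensions E L b)"
proof -
  have "\<exists>w n. w \<notin> L \<and> w = (p ^^ n) v" for v using ancestor_outside[OF assms] by metis
  then obtain up un where up: "\<And>v. up v \<notin> L" "\<And>v. up v = (p ^^ un v) v" by metis
  have "\<exists>w n. w \<notin> L \<and> v = (p ^^ n) w" for v using descendant_outside[OF assms] by metis
  then obtain dn dm where dn: "\<And>v. dn v \<notin> L" "\<And>v. v = (p ^^ dm v) (dn v)" by metis
  have "monotone_extensions E L b
      \<subseteq> (\<lambda>g v. if v \<in> L then g v else b v) ` (PiE L (\<lambda>v. {b (dn v)..b (up v)}))"
  proof
    fix h assume "h \<in> monotone_extensions E L b"
    then have h: "h \<in> Mon E" "\<And>v. v \<notin> L \<Longrightarrow> h v = b v"
      by (auto simp: monotone_extensions_def)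
    have "h v \<in> {b (dn v)..b (up v)}" for v
      using Mon_funpow[OF h(1), of v "un v"] Mon_funpow[OF h(1), of "dn v" "dm v"]
        h(2)[OF up(1)[of v]] h(2)[OF dn(1)[of v]] up(2)[of v] dn(2)[of v] by simp
    then have "restrict h L \<in> PiE L (\<lambda>v. {b (dn v)..b (up v)})" by (auto simp: restrict_def)
    moreover have "h = (\<lambda>v. if v \<in> L then restrict h L v else b v)"
      using h(2) by (auto simp: fun_eq_iff)
    ultimately show "h \<in> (\<lambda>g v. if v \<in> L then g v else b v) ` (PiE L (\<lambda>v. {b (dn v)..b (up v)}))"
      by blast
  qed
  moreover have "finite (PiE L (\<lambda>v. {b (dn v)..b (up v)}))"
    using assms by (intro finite_PiE) auto
  ultimately show ?thesis by (meson finite_imageI finite_subset)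
qed

lemma card_extensions_pos: "finite L \<Longrightarrow> b \<in> Mon E \<Longrightarrow> 0 < card (monotone_extensions E L b)"
  using finite_extensions[of L b] self_in_extensions[of b L] by (auto simp: card_gt_0_iff)

lemma emeasure_spec:
  assumes "finite L" "b \<in> Mon E"
  shows "emeasure (spec E L b) A =
    of_nat (card (monotone_extensions E L b \<inter> A)) / of_nat (card (monotone_extensions E L b))"
  using card_extensions_pos[OF assms] finite_extensions[OF assms(1), of b]
    self_in_extensions[OF assms(2), of L]
  unfolding spec_def
  by (subst emeasure_pmf_of_set)
    (auto simp: divide_ennreal[symmetric] ennreal_of_nat_eq_real_of_nat)

end

section \<open>Geometric distributions\<close>

lemma exp_neg_0 [simp]: "exp_neg 0 = 1"
  by (simp add: exp_neg_def)

lemma exp_neg_nonneg [simp]: "0 \<le> exp_neg a"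
  by (simp add: exp_neg_def)

lemma exp_neg_ennreal: "0 \<le> a \<Longrightarrow> exp_neg (ennreal a) = exp (- a)"
  by (simp add: exp_neg_def)

lemma exp_neg_add: "exp_neg (a + b) = exp_neg a * exp_neg b"
proof (cases "a = \<infinity> \<or> b = \<infinity>")
  case False
  then show ?thesis
    by (auto simp: exp_neg_def enn2real_plus less_top exp_add[symmetric])
qed (auto simp: exp_neg_def)

lemma exp_neg_sum: "exp_neg (sum f A) = (\<Prod>x\<in>A. exp_neg (f x))"
  by (induction A rule: infinite_finite_induct) (simp_all add: exp_neg_add)

lemma exp_neg_antimono: "a \<le> b \<Longrightarrow> exp_neg b \<le> exp_neg a"
  by (auto simp: exp_neg_def top_unique enn2real_mono less_top)

lemma exp_neg_inj: "exp_neg a = exp_neg b \<longleftrightarrow> a = b"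
  by (cases a; cases b) (auto simp: exp_neg_def)

text \<open>\<open>enn2real\<close> jumps to its default value 0 at \<infinity>, so continuity of
  \<open>exp_neg\<close> there is shown by hand and only finite limits go through
  \<open>enn2real\<close>.\<close>

lemma tendsto_exp_neg:
  assumes "(f \<longlongrightarrow> a) F"
  shows "((\<lambda>x. exp_neg (f x)) \<longlongrightarrow> exp_neg a) F"
proof (cases "a = \<infinity>")
  case False
  then have "eventually (\<lambda>x. f x < \<infinity>) F"
    using assms by (intro order_tendstoD) (auto simp: less_top)
  moreover have "((\<lambda>x. exp (- enn2real (f x))) \<longlongrightarrow> exp (- enn2real a)) F"
    using assms False by (intro tendsto_intros tendsto_enn2real) (auto simp: less_top)
  ultimately show ?thesis
    using False by (auto simp: exp_neg_def elim!: Lim_transform_eventually eventually_mono)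
next
  case True
  show ?thesis
  proof (rule order_tendstoI)
    fix y :: real
    assume "exp_neg a < y"
    then have y: "0 < y" using True by (simp add: exp_neg_def)
    \<comment> \<open>Beyond the level \<open>1 - ln y\<close> the value is at most
      \<open>y / exp 1\<close>; the cut at 0 is there because \<open>ennreal\<close> sends negative
      reals to 0.\<close>
    have "eventually (\<lambda>x. ennreal (max 0 (1 - ln y)) < f x) F"
      using assms True by (intro order_tendstoD) auto
    then show "eventually (\<lambda>x. exp_neg (f x) < y) F"
    proof eventually_elim
      case (elim x)
      then have "exp_neg (f x) \<le> exp (- max 0 (1 - ln y))"
        using exp_neg_antimono[OF less_imp_le[OF elim]] exp_neg_ennreal[of "max 0 (1 - ln y)"]
        by (metis max.cobounded1)
      also have "\<dots> \<le> exp (ln y - 1)" by simp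
      also have "\<dots> < exp (ln y)" by (subst exp_less_cancel_iff) simp
      finally show ?case using y by simp
    qed
  next
    fix y :: real
    assume "y < exp_neg a"
    then have "y < 0" using True by (simp add: exp_neg_def)
    then show "eventually (\<lambda>x. y < exp_neg (f x)) F"
      by (intro always_eventually allI) (use exp_neg_nonneg less_le_trans in blast)
  qed
qed

text \<open>Tails carry no normalising factor, so an intersection of independent tail events has
  probability \<open>exp_neg\<close> of a weighted sum of flows. For this reason events below are
  described by lower bounds on gradients.\<close>

lemma measure_Geom_atLeast:
  assumes "0 < a"
  shows "measure (measure_pmf (Geom a)) {m..} = exp_neg (of_nat m * a)"
proof (induction m)
  case 0
  have "{0::nat..} = UNIV" by auto
  then show ?case by simp
next
  case (Suc m)
  have "measure (measure_pmf (Geom a)) {m..} =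
      measure (measure_pmf (Geom a)) {m} + measure (measure_pmf (Geom a)) {Suc m..}"
    by (subst measure_pmf.finite_measure_Union[symmetric]) (auto intro!: arg_cong2[where f=measure])
  then show ?case
    using Suc assms
    by (simp add: measure_pmf_single pmf_Geom exp_neg_add distrib_right algebra_simps)
qed

section \<open>The gradient sigma-algebra\<close>

lemma space_gradient_space [simp]: "space gradient_space = UNIV"
  by (simp add: gradient_space_def)

lemma sets_gradient_space:
  "sets gradient_space = sigma_sets UNIV {{h :: 'v \<Rightarrow> int. h y - h z \<in> B} |y z B. True}"
  by (simp add: gradient_space_def)

lemma measurable_gradient_diff [measurable]:
  "(\<lambda>h. h y - h z) \<in> measurable gradient_space (count_space UNIV)"
proof (rule measurableI)
  fix B :: "int set"
  have "{h. h y - h z \<in> B} \<in> sets gradient_space"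
    unfolding sets_gradient_space by (intro sigma_sets.Basic) blast
  then show "(\<lambda>h. h y - h z) -` B \<inter> space gradient_space \<in> sets gradient_space"
    by (simp add: vimage_def)
qed simp

lemma measurable_to_gradient_space:
  fixes f :: "'a \<Rightarrow> 'v \<Rightarrow> int"
  assumes "\<And>y z. (\<lambda>x. f x y - f x z) \<in> measurable M (count_space UNIV)"
  shows "f \<in> measurable M gradient_space"
  unfolding gradient_space_def
proof (rule measurable_measure_of)
  fix A :: "('v \<Rightarrow> int) set" assume "A \<in> {{h. h y - h z \<in> B} |y z B. True}"
  then obtain y z B where A: "A = {h. h y - h z \<in> B}" by blast
  have "f -` A \<inter> space M = (\<lambda>x. f x y - f x z) -` B \<inter> space M" by (auto simp: A)
  also have "\<dots> \<in> sets M" by (rule measurable_sets[OF assms]) simp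
  finally show "f -` A \<inter> space M \<in> sets M" .
qed auto

lemma measurable_int_binop:
  fixes f g :: "'a \<Rightarrow> int"
  assumes [measurable]: "f \<in> measurable M (count_space UNIV)" "g \<in> measurable M (count_space UNIV)"
  shows "(\<lambda>x. op (f x) (g x)) \<in> measurable M (count_space UNIV)"
proof -
  have 1: "(\<lambda>x. op i (g x)) \<in> measurable M (count_space UNIV)" for i
    by (rule measurable_compose[OF assms(2)]) simp
  show ?thesis by (rule measurable_compose_countable[OF 1 assms(1)])
qed

section \<open>Translations of height functions and lower bounds on gradients\<close>

definition translate :: "('v \<Rightarrow> int) \<Rightarrow> ('v \<Rightarrow> int) \<Rightarrow> 'v \<Rightarrow> int" where
  "translate f h = (\<lambda>v. h v + f v)"

lemma translate_simps [simp]: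
  "translate (\<lambda>v. - f v) (translate f h) = h"
  "translate f (translate (\<lambda>v. - f v) h) = h"
  "translate (\<lambda>v. 0) h = h"
  by (simp_all add: translate_def)

lemma measurable_translate_gradient [measurable]:
  "translate f \<in> measurable gradient_space gradient_space"
proof (rule measurable_to_gradient_space)
  fix y z
  have "(\<lambda>h. (h y - h z) + (f y - f z)) \<in> measurable gradient_space (count_space UNIV)"
    by (rule measurable_int_binop[where op = "(+)"]) auto
  then show "(\<lambda>h. translate f h y - translate f h z) \<in> measurable gradient_space (count_space UNIV)"
    by (simp add: translate_def algebra_simps)
qed

locale countable_up_tree = rooted_up_tree E for E :: "'v::countable rel"
begin

lemma measurable_grad [measurable]:
  "grad v \<in> measurable gradient_space (count_space UNIV)"
  unfolding grad_def[abs_def] by measurable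

lemma Mon_in_gradient [measurable]: "Mon E \<in> sets gradient_space"
proof -
  have "Mon E = {h \<in> space gradient_space. \<forall>v. 0 \<le> grad v h}" by (auto simp: Mon_iff)
  also have "\<dots> \<in> sets gradient_space" by measurable
  finally show ?thesis .
qed

text \<open>A pi-system adapted to flow measures: intersecting takes the larger bounds, and lower
  bounds on gradients have explicit probabilities. Infinite \<open>F\<close> still gives measurable
  sets, as there are countably many vertices.\<close>

definition gradient_generator :: "('v \<Rightarrow> int) set set" where
  "gradient_generator = range (\<lambda>(F, k). {h. \<forall>u\<in>F. k u \<le> grad u h})"

lemma gradient_generatorI: "{h. \<forall>u\<in>F. k u \<le> grad u h} \<in> gradient_generator"
  unfolding gradient_generator_def by (rule range_eqI[of _ _ "(F, k)"]) simp

lemma gradient_generatorE: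
  assumes "A \<in> gradient_generator"
  obtains F k where "A = {h. \<forall>u\<in>F. k u \<le> grad u h}"
  using assms unfolding gradient_generator_def by auto

lemma Int_stable_gradient_generator: "Int_stable gradient_generator"
  unfolding Int_stable_def
proof (intro ballI)
  fix A B assume "A \<in> gradient_generator" "B \<in> gradient_generator"
  then obtain F k F' k' where
    A: "A = {h. \<forall>u\<in>F. k u \<le> grad u h}" and B: "B = {h. \<forall>u\<in>F'. k' u \<le> grad u h}"
    by (elim gradient_generatorE)
  define l where "l u = (if u \<in> F then if u \<in> F' then max (k u) (k' u) else k u else k' u)" for u
  have "A \<inter> B = {h. \<forall>u\<in>F \<union> F'. l u \<le> grad u h}"
    unfolding A B l_def by (auto split: if_splits)
  then show "A \<inter> B \<in> gradient_generator" by (simp only: gradient_generatorI)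
qed

text \<open>The height difference of two vertices is a difference of two sums of gradients, taken
  along the lines up to a common ancestor.\<close>

lemma sets_gradient_space_generator:
  "sets gradient_space = sigma_sets UNIV gradient_generator"
proof
  let ?M = "sigma UNIV gradient_generator"
  have grad: "grad u \<in> measurable ?M (count_space UNIV)" for u
  proof (rule iffD2[OF measurable_count_space_eq2_countable], intro conjI ballI)
    fix k :: int
    have ge: "{h. j \<le> grad u h} \<in> sets ?M" for j
    proof -
      have "{h. \<forall>w\<in>{u}. (\<lambda>_. j) w \<le> grad w h} \<in> gradient_generator"
        by (rule gradient_generatorI)
      then show ?thesis by (simp add: sigma_sets.Basic)
    qed
    have "grad u -` {k} \<inter> space ?M = {h. k \<le> grad u h} - {h. k + 1 \<le> grad u h}" by auto
    with ge show "grad u -` {k} \<inter> space ?M \<in> sets ?M" by (metis sets.Diff)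
  qed auto
  have up: "(\<lambda>h. h ((p ^^ n) y) - h y) \<in> measurable ?M (count_space UNIV)" for n y
  proof (induction n)
    case (Suc n)
    have "(\<lambda>h. h ((p ^^ Suc n) y) - h y) = (\<lambda>h. grad ((p ^^ n) y) h + (h ((p ^^ n) y) - h y))"
      by (simp add: grad_def fun_eq_iff)
    then show ?case using measurable_int_binop[OF grad Suc, of "(+)"] by simp
  qed simp
  have diff: "(\<lambda>h. h y - h z) \<in> measurable ?M (count_space UNIV)" for y z :: 'v
  proof -
    obtain m n where mn: "(p ^^ m) y = (p ^^ n) z" using common_ancestor by blast
    have "(\<lambda>h :: 'v \<Rightarrow> int. (h ((p ^^ n) z) - h z) - (h ((p ^^ m) y) - h y)) \<in> measurable ?M (count_space UNIV)"
      by (rule measurable_int_binop[where op = "(-)", OF up up])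
    moreover have "(h ((p ^^ n) z) - h z) - (h ((p ^^ m) y) - h y) = h y - h z" for h :: "'v \<Rightarrow> int"
      unfolding mn by linarith
    ultimately show ?thesis by (simp only:)
  qed
  have "{h. h y - h z \<in> B} \<in> sigma_sets UNIV gradient_generator" for y z :: 'v and B
  proof -
    have "{h. h y - h z \<in> B} = (\<lambda>h. h y - h z) -` B \<inter> space ?M" by auto
    also have "\<dots> \<in> sets ?M" by (rule measurable_sets[OF diff]) simp
    finally show ?thesis by simp
  qed
  then have "{{h :: 'v \<Rightarrow> int. h y - h z \<in> B} |y z B. True} \<subseteq> sigma_sets UNIV gradient_generator"
    by blast
  then show "sets gradient_space \<subseteq> sigma_sets UNIV gradient_generator"
    unfolding sets_gradient_space by (rule sigma_sets_mono)
next
  have "A \<in> sets gradient_space" if gen: "A \<in> gradient_generator" for A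
  proof -
    obtain F k where A: "A = {h. \<forall>u\<in>F. k u \<le> grad u h}"
      using gen by (rule gradient_generatorE)
    have "{h \<in> space gradient_space. \<forall>u\<in>F. k u \<le> grad u h} \<in> sets gradient_space"
      by measurable
    then show ?thesis by (simp add: A)
  qed
  then have "sigma_sets (space gradient_space) gradient_generator \<subseteq> sets gradient_space"
    by (intro sets.sigma_sets_subset) auto
  then show "sigma_sets UNIV gradient_generator \<subseteq> sets gradient_space" by simp
qed

text \<open>The domain of the move by \<open>f\<close>. \<open>translate f\<close> maps it
  bijectively onto \<open>mon_pair (\<lambda>v. - f v)\<close>, the domain of the reverse
  move.\<close>

definition mon_pair :: "('v \<Rightarrow> int) \<Rightarrow> ('v \<Rightarrow> int) set" where
  "mon_pair f = {h \<in> Mon E. translate f h \<in> Mon E}"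

text \<open>
  For all finitely supported \<open>f\<close> together, this is equivalent to the Gibbs property.
\<close>

definition translation_invariant :: "('v \<Rightarrow> int) measure \<Rightarrow> ('v \<Rightarrow> int) \<Rightarrow> bool" where
  "translation_invariant M f \<longleftrightarrow>
     (\<forall>F \<in> borel_measurable M.
        (\<integral>\<^sup>+h\<in>mon_pair f. F (translate f h) \<partial>M) = (\<integral>\<^sup>+h\<in>mon_pair (\<lambda>v. - f v). F h \<partial>M))"

lemma mon_pair_in_gradient [measurable]: "mon_pair f \<in> sets gradient_space"
proof -
  have "mon_pair f = Mon E \<inter> (translate f -` Mon E \<inter> space gradient_space)"
    by (auto simp: mon_pair_def)
  also have "\<dots> \<in> sets gradient_space" by measurable
  finally show ?thesis .
qed

end

section \<open>Flow measures\<close>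

locale flow_tree = countable_up_tree E for E :: "'v::countable rel" +
  fixes \<phi> :: "'v \<times> 'v \<Rightarrow> ennreal" and \<mu> :: "('v \<Rightarrow> int) measure"
  assumes flow: "flow E \<phi>" and flow_measure: "flow_measure E \<phi> \<mu>"
begin

sublocale prob_space \<mu>
  using flow_measure by (simp add: flow_measure_def)

lemma sets_mu [measurable_cong]: "sets \<mu> = sets gradient_space"
  using flow_measure by (simp add: flow_measure_def)

lemma space_mu [simp]: "space \<mu> = UNIV"
  using sets_eq_imp_space_eq[OF sets_mu] by simp

definition flux :: "'v \<Rightarrow> ennreal" where "flux v = \<phi> (v, p v)"

lemma flux_pos: "0 < flux v"
proof -
  have "(v, p v) \<in> E" by (simp add: edge_iff)
  with flow show ?thesis unfolding flow_def flux_def by blast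
qed

lemma flux_children: "flux v = (\<Sum>\<^sub>\<infinity>u | p u = v. flux u)"
proof -
  have "flux v = (\<Sum>\<^sub>\<infinity>u | p u = v. \<phi> (u, v))"
    using flow by (simp add: flow_def flux_def edge_iff eq_commute)
  also have "\<dots> = (\<Sum>\<^sub>\<infinity>u | p u = v. flux u)"
    by (intro infsum_cong) (auto simp: flux_def)
  finally show ?thesis .
qed

lemma prob_grad_ge: "prob {h. int m \<le> grad v h} = exp_neg (of_nat m * flux v)"
proof -
  have "prob {h. int m \<le> grad v h} = measure (distr \<mu> (count_space UNIV) (grad v)) {int m..}"
    by (subst measure_distr) (auto simp: vimage_def)
  also have "distr \<mu> (count_space UNIV) (grad v) = measure_pmf (map_pmf int (Geom (flux v)))"
    using flow_measure by (auto simp: flow_measure_def edge_iff grad_def[abs_def] flux_def)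
  also have "measure \<dots> {int m..} = measure (measure_pmf (Geom (flux v))) {m..}"
    by (simp add: vimage_def atLeast_def)
  finally show ?thesis by (simp add: measure_Geom_atLeast[OF flux_pos])
qed

lemma prob_finite_grad_ge:
  assumes "finite F"
  shows "prob {h. \<forall>v\<in>F. int (m v) \<le> grad v h} = exp_neg (\<Sum>v\<in>F. of_nat (m v) * flux v)"
proof (cases "F = {}")
  case True
  then show ?thesis using prob_space by simp
next
  case False
  let ?e = "\<lambda>v. (v, p v)" and ?X = "\<lambda>(x, y) h. h y - h x"
  have "indep_vars (\<lambda>_. count_space UNIV) ?X E"
    using flow_measure by (simp add: flow_measure_def)
  then have "prob (\<Inter>e\<in>?e ` F. ?X e -` {int (m (fst e))..} \<inter> space \<mu>) =
      (\<Prod>e\<in>?e ` F. prob (?X e -` {int (m (fst e))..} \<inter> space \<mu>))"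
    using assms False by (intro indep_varsD) (auto simp: edge_iff)
  also have "(\<Inter>e\<in>?e ` F. ?X e -` {int (m (fst e))..} \<inter> space \<mu>)
      = {h. \<forall>v\<in>F. int (m v) \<le> grad v h}"
    by (auto simp: grad_def)
  also have "(\<Prod>e\<in>?e ` F. prob (?X e -` {int (m (fst e))..} \<inter> space \<mu>))
      = (\<Prod>v\<in>F. prob {h. int (m v) \<le> grad v h})"
    by (subst prod.reindex) (auto simp: inj_on_def grad_def vimage_def)
  finally show ?thesis by (simp add: prob_grad_ge exp_neg_sum)
qed

text \<open>Continuity from above along the finite sets \<open>F n\<close> of vertices with code
  below \<open>n\<close>. The sum may be infinite; the probability is then 0, by continuity of
  \<open>exp_neg\<close> at \<infinity>.\<close>

lemma prob_all_grad_ge: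
  "prob {h. \<forall>v. int (m v) \<le> grad v h} = exp_neg (\<Sum>\<^sub>\<infinity>v. of_nat (m v) * flux v)"
proof -
  define F where "F n = {v :: 'v. to_nat v < n}" for n
  have fin: "finite (F n)" for n
    unfolding F_def by (rule finite_vimageI[of "{..<n}" to_nat, unfolded vimage_def lessThan_def, simplified])
  let ?A = "\<lambda>n. {h. \<forall>v\<in>F n. int (m v) \<le> grad v h}"
  have "filterlim F (finite_subsets_at_top UNIV) sequentially"
    unfolding filterlim_finite_subsets_at_top
  proof (intro allI impI, safe)
    fix X :: "'v set" assume X: "finite X"
    show "eventually (\<lambda>n. finite (F n) \<and> X \<subseteq> F n \<and> F n \<subseteq> UNIV) sequentially"
      using eventually_gt_at_top[of "Max (to_nat ` X)"]
    proof eventually_elim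
      case (elim n)
      then have "to_nat v < n" if "v \<in> X" for v
        using X that by (meson Max_ge finite_imageI image_eqI le_less_trans)
      then show ?case using fin by (auto simp: F_def)
    qed
  qed
  moreover have "(sum (\<lambda>v. of_nat (m v) * flux v) \<longlongrightarrow> (\<Sum>\<^sub>\<infinity>v. of_nat (m v) * flux v))
      (finite_subsets_at_top UNIV)"
    using has_sum_infsum[OF nonneg_summable_on_complete, of UNIV "\<lambda>v. of_nat (m v) * flux v"]
    by (simp add: has_sum_def)
  ultimately have "(\<lambda>n. exp_neg (\<Sum>v\<in>F n. of_nat (m v) * flux v)) \<longlonglongrightarrow>
      exp_neg (\<Sum>\<^sub>\<infinity>v. of_nat (m v) * flux v)"
    by (intro tendsto_exp_neg) (rule filterlim_compose)
  moreover have "(\<lambda>n. prob (?A n)) \<longlonglongrightarrow> prob (\<Inter>n. ?A n)"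
  proof (rule finite_Lim_measure_decseq)
    have "?A n = {h \<in> space \<mu>. \<forall>v\<in>F n. int (m v) \<le> grad v h}" for n by simp
    then show "range ?A \<subseteq> sets \<mu>" by (auto simp del: space_mu)
    show "decseq ?A" by (auto simp: decseq_def F_def)
  qed
  moreover have "(\<Inter>n. ?A n) = {h. \<forall>v. int (m v) \<le> grad v h}"
    by (auto simp: F_def)
  ultimately show ?thesis
    using LIMSEQ_unique by (auto simp: prob_finite_grad_ge[OF fin])
qed

lemma AE_Mon: "AE h in \<mu>. h \<in> Mon E"
proof -
  have "AE h in \<mu>. 0 \<le> grad v h" for v
  proof -
    have "AE h in \<mu>. h \<in> {h. 0 \<le> grad v h}"
      by (rule AE_prob_1) (use prob_grad_ge[of 0 v] in simp)
    then show ?thesis by simp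
  qed
  then show ?thesis by (simp add: Mon_iff AE_all_countable)
qed

end

section \<open>Finitely supported translations and the Gibbs property\<close>

context countable_up_tree
begin

lemma translation_invariant_zero: "translation_invariant M (\<lambda>v. 0)"
  by (simp add: translation_invariant_def)

lemma translation_invariant_uminus:
  assumes sets [measurable_cong]: "sets M = sets gradient_space" and inv: "translation_invariant M f"
  shows "translation_invariant M (\<lambda>v. - f v)"
  unfolding translation_invariant_def
proof
  fix F :: "('v \<Rightarrow> int) \<Rightarrow> ennreal" assume [measurable]: "F \<in> borel_measurable M"
  have "(\<lambda>h. F (translate (\<lambda>v. - f v) h)) \<in> borel_measurable M" by measurable
  with inv have "(\<integral>\<^sup>+h\<in>mon_pair f. F (translate (\<lambda>v. - f v) (translate f h)) \<partial>M) =
      (\<integral>\<^sup>+h\<in>mon_pair (\<lambda>v. - f v). F (translate (\<lambda>v. - f v) h) \<partial>M)"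
    unfolding translation_invariant_def by (rule bspec)
  then show "(\<integral>\<^sup>+h\<in>mon_pair (\<lambda>v. - f v). F (translate (\<lambda>v. - f v) h) \<partial>M) =
      (\<integral>\<^sup>+h\<in>mon_pair (\<lambda>v. - (- f v)). F h \<partial>M)"
    by simp
qed

text \<open>Two substitutions, one per move. By \<open>mid\<close> the intermediate function is
  monotone whenever both ends are, so the domain of the composite move consists exactly of the
  functions on which the two moves can be made in turn.\<close>

lemma translation_invariant_add:
  assumes sets [measurable_cong]: "sets M = sets gradient_space"
    and f: "translation_invariant M f" and g: "translation_invariant M g"
    and mid: "\<And>h. h \<in> Mon E \<Longrightarrow> translate (\<lambda>v. f v + g v) h \<in> Mon E \<Longrightarrow> translate f h \<in> Mon E"
  shows "translation_invariant M (\<lambda>v. f v + g v)"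
  unfolding translation_invariant_def
proof
  fix F :: "('v \<Rightarrow> int) \<Rightarrow> ennreal" assume [measurable]: "F \<in> borel_measurable M"
  let ?nf = "\<lambda>v. - f v" and ?ng = "\<lambda>v. - g v" and ?s = "\<lambda>v. f v + g v"
  have comp: "translate ?s h = translate g (translate f h)"
    and compn: "translate (\<lambda>v. - ?s v) h = translate ?nf (translate ?ng h)" for h :: "'v \<Rightarrow> int"
    by (simp_all add: translate_def algebra_simps)
  have mp: "h \<in> mon_pair ?s \<longleftrightarrow> h \<in> mon_pair f \<and> translate f h \<in> mon_pair g" for h
    using mid[of h] by (auto simp: mon_pair_def comp)
  have mpn: "h \<in> mon_pair (\<lambda>v. - ?s v) \<longleftrightarrow> h \<in> mon_pair ?ng \<and> translate ?ng h \<in> mon_pair ?nf" for h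
  proof -
    let ?k = "translate ?nf (translate ?ng h)"
    \<comment> \<open>The backward move from \<open>h\<close> passes through the same midpoint as
      the forward move from \<open>?k\<close>, so \<open>mid\<close> is applied to
      \<open>?k\<close>.\<close>
    have "translate ?s ?k = h" by (simp add: translate_def)
    moreover have "h \<in> mon_pair (\<lambda>v. - ?s v) \<longleftrightarrow> h \<in> Mon E \<and> ?k \<in> Mon E"
      unfolding mon_pair_def compn by simp
    ultimately show ?thesis
      using mid[of ?k] by (auto simp: mon_pair_def)
  qed
  have "(\<integral>\<^sup>+h\<in>mon_pair ?s. F (translate ?s h) \<partial>M) =
      (\<integral>\<^sup>+h\<in>mon_pair f. (F (translate g (translate f h)) * indicator (mon_pair g) (translate f h)) \<partial>M)"
    by (intro nn_integral_cong) (auto simp: mp comp indicator_def)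
  also have "\<dots> = (\<integral>\<^sup>+h\<in>mon_pair ?nf. (F (translate g h) * indicator (mon_pair g) h) \<partial>M)"
    using f unfolding translation_invariant_def
    by (rule bspec[where x="\<lambda>h. F (translate g h) * indicator (mon_pair g) h"]) measurable
  also have "\<dots> = (\<integral>\<^sup>+h\<in>mon_pair g. (F (translate g h)
      * indicator (mon_pair ?nf) (translate ?ng (translate g h))) \<partial>M)"
    by (intro nn_integral_cong) (auto simp: indicator_def)
  also have "\<dots> = (\<integral>\<^sup>+h\<in>mon_pair ?ng. (F h * indicator (mon_pair ?nf) (translate ?ng h)) \<partial>M)"
    using g unfolding translation_invariant_def
    by (rule bspec[where x="\<lambda>h. F h * indicator (mon_pair ?nf) (translate ?ng h)"]) measurable
  also have "\<dots> = (\<integral>\<^sup>+h\<in>mon_pair (\<lambda>v. - ?s v). F h \<partial>M)"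
    by (intro nn_integral_cong) (auto simp: mpn indicator_def simp del: minus_add_distrib)
  finally show "(\<integral>\<^sup>+h\<in>mon_pair ?s. F (translate ?s h) \<partial>M) = (\<integral>\<^sup>+h\<in>mon_pair (\<lambda>v. - ?s v). F h \<partial>M)" .
qed

text \<open>
  A unit of \<open>f\<close> is added at a vertex of the support whose parent is outside it; there the
  intermediate function stays monotone.
\<close>

lemma translation_invariant_nonneg:
  assumes sets: "sets M = sets gradient_space"
    and single: "\<And>v. translation_invariant M (indicator {v})"
    and "finite S" "\<And>v. v \<notin> S \<Longrightarrow> f v = 0" "\<And>v. 0 \<le> f v"
  shows "translation_invariant M f"
  using assms(4,5)
proof (induction "\<Sum>v\<in>S. nat (f v)" arbitrary: f rule: less_induct)
  case less
  show ?case
  proof (cases "\<forall>v. f v = 0")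
    case True
    then have "f = (\<lambda>v. 0)" by auto
    then show ?thesis using translation_invariant_zero by simp
  next
    case False
    then obtain u where u: "f u \<noteq> 0" by blast
    obtain n where "(p ^^ n) u \<notin> S" using ancestor_outside[OF \<open>finite S\<close>] .
    then have ex: "\<exists>n. f ((p ^^ n) u) = 0" using less by blast
    define n where "n = (LEAST n. f ((p ^^ n) u) = 0)"
    have n: "f ((p ^^ n) u) = 0" using LeastI_ex[OF ex] by (simp add: n_def)
    with u have "n \<noteq> 0" by (metis funpow_0)
    then obtain m where m: "n = Suc m" by (cases n) auto
    define v where "v = (p ^^ m) u"
    have fv: "f v \<noteq> 0" using not_less_Least[of m "\<lambda>n. f ((p ^^ n) u) = 0"] m by (simp add: n_def v_def)
    have fpv: "f (p v) = 0" using n by (simp add: m v_def)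
    have fv1: "1 \<le> f v" using fv less.prems(2)[of v] by linarith
    have vS: "v \<in> S" using fv less by blast
    define g where "g w = f w - indicator {v} w" for w
    have g: "0 \<le> g w" "w \<notin> S \<Longrightarrow> g w = 0" for w
      using fv1 less.prems vS by (auto simp: g_def indicator_def)
    have "(\<Sum>w\<in>S. nat (g w)) < (\<Sum>w\<in>S. nat (f w))"
    proof (rule sum_strict_mono_ex1)
      show "\<exists>w\<in>S. nat (g w) < nat (f w)"
        using vS fv1 by (intro bexI[of _ v]) (auto simp: g_def)
    qed (use \<open>finite S\<close> in \<open>auto simp: g_def indicator_def\<close>)
    then have inv: "translation_invariant M g" using less.hyps[of g] g by blast
    have "translation_invariant M (\<lambda>w. indicator {v} w + g w)"
    proof (rule translation_invariant_add[OF sets single inv])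
      fix h assume h: "h \<in> Mon E" "translate (\<lambda>w. indicator {v} w + g w) h \<in> Mon E"
      \<comment> \<open>As \<open>f (p v) = 0\<close>, the whole move lowers the gradient at
        \<open>v\<close> by \<open>f v\<close>; monotonicity at its end leaves room for the first
        unit.\<close>
      have "0 \<le> grad v h - f v"
        using h(2)[unfolded Mon_iff, THEN spec[of _ v]]
        by (simp add: g_def translate_def grad_def fpv)
      with fv1 have v1: "1 \<le> grad v h" by linarith
      show "translate (indicator {v}) h \<in> Mon E"
        unfolding Mon_iff
      proof
        fix u
        have "0 \<le> grad u h" using h(1) by (simp add: Mon_iff)
        then show "0 \<le> grad u (translate (indicator {v}) h)"
          using v1 parent_neq[of v]
          by (cases "u = v") (simp_all add: translate_def grad_add grad_indicator)
      qed
    qed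
    then show ?thesis by (simp add: g_def)
  qed
qed

text \<open>The positive part is added first. The intermediate function is the pointwise maximum of
  \<open>h\<close> and \<open>translate f h\<close>, and a maximum of monotone functions is
  monotone.\<close>

lemma translation_invariant_finite_support:
  assumes sets: "sets M = sets gradient_space"
    and single: "\<And>v. translation_invariant M (indicator {v})"
    and fin: "finite {v. f v \<noteq> 0}"
  shows "translation_invariant M f"
proof -
  have pos: "translation_invariant M (\<lambda>v. max (f v) 0)"
    and neg: "translation_invariant M (\<lambda>v. max (- f v) 0)"
    by (rule translation_invariant_nonneg[OF sets single fin]; simp)+
  have "translation_invariant M (\<lambda>v. max (f v) 0 + - max (- f v) 0)"
  proof (rule translation_invariant_add[OF sets pos translation_invariant_uminus[OF sets neg]])
    fix h assume h: "h \<in> Mon E" "translate (\<lambda>v. max (f v) 0 + - max (- f v) 0) h \<in> Mon E"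
    moreover have "max (f v) 0 + - max (- f v) 0 = f v" for v by auto
    ultimately have "translate f h \<in> Mon E" by simp
    show "translate (\<lambda>v. max (f v) 0) h \<in> Mon E"
      unfolding Mon_iff
    proof
      fix v
      have "h v \<le> h (p v)" "h v + f v \<le> h (p v) + f (p v)"
        using h(1) \<open>translate f h \<in> Mon E\<close>
        unfolding Mon_iff by (simp_all add: translate_def grad_def)
      then show "0 \<le> grad v (translate (\<lambda>v. max (f v) 0) h)"
        unfolding translate_def grad_def by linarith
    qed
  qed
  moreover have "(\<lambda>v. max (f v) 0 + - max (- f v) 0) = f" by auto
  ultimately show ?thesis by simp
qed

end

section \<open>Heights: counting extensions, and the Gibbs property in terms of moves\<close>

lemma space_height_space [simp]: "space height_space = UNIV"
  by (simp add: height_space_def space_PiM PiE_UNIV_domain)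

lemma measurable_height_component [measurable]:
  "(\<lambda>h. h v) \<in> measurable height_space (count_space UNIV)"
  unfolding height_space_def by measurable

lemma measurable_to_height_space:
  assumes "\<And>v. (\<lambda>x. f x v) \<in> measurable M (count_space UNIV)"
  shows "f \<in> measurable M height_space"
  unfolding height_space_def by (rule measurable_PiM_single') (use assms in auto)

lemma gradient_subset_height: "sets gradient_space \<subseteq> sets (height_space :: ('v \<Rightarrow> int) measure)"
proof
  fix A :: "('v \<Rightarrow> int) set" assume A: "A \<in> sets gradient_space"
  have "(\<lambda>h. h) \<in> measurable height_space (gradient_space :: ('v \<Rightarrow> int) measure)"
    by (intro measurable_to_gradient_space measurable_int_binop[where op = "(-)"]) measurable
  from measurable_sets[OF this A] show "A \<in> sets height_space" by simp
qed

lemma measurable_translate_height [measurable]: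
  "translate f \<in> measurable height_space height_space"
proof (rule measurable_to_height_space)
  fix v
  show "(\<lambda>h. translate f h v) \<in> measurable height_space (count_space UNIV)"
    unfolding translate_def by (intro measurable_int_binop[where op = "(+)"]) measurable
qed

context countable_up_tree
begin

lemma Mon_in_height [measurable]: "Mon E \<in> sets height_space"
  using gradient_subset_height Mon_in_gradient by blast

lemma mon_pair_in_height [measurable]: "mon_pair f \<in> sets height_space"
  using gradient_subset_height mon_pair_in_gradient by blast

lemma extensions_translate:
  assumes "\<And>v. v \<notin> L \<Longrightarrow> f v = 0"
  shows "monotone_extensions E L (translate f b) = monotone_extensions E L b"
  using assms by (auto simp: monotone_extensions_def translate_def)

lemma countable_finitely_supported:
  assumes "finite L"
  shows "countable {f :: 'v \<Rightarrow> int. \<forall>v. v \<notin> L \<longrightarrow> f v = 0}"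
proof -
  have "{f :: 'v \<Rightarrow> int. \<forall>v. v \<notin> L \<longrightarrow> f v = 0}
      \<subseteq> (\<lambda>g v. if v \<in> L then g v else 0) ` (PiE L (\<lambda>_. UNIV))"
  proof
    fix f :: "'v \<Rightarrow> int" assume "f \<in> {f. \<forall>v. v \<notin> L \<longrightarrow> f v = 0}"
    then have "f = (\<lambda>v. if v \<in> L then restrict f L v else 0)" by (auto simp: fun_eq_iff)
    moreover have "restrict f L \<in> PiE L (\<lambda>_. UNIV)" by simp
    ultimately show "f \<in> (\<lambda>g v. if v \<in> L then g v else 0) ` (PiE L (\<lambda>_. UNIV))"
      by (rule image_eqI)
  qed
  moreover have "countable (PiE L (\<lambda>_. UNIV :: int set))"
    using assms by (intro countable_PiE) auto
  ultimately show ?thesis by (meson countable_image countable_subset)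
qed

text \<open>Counting moves \<open>f\<close> instead of extensions makes the index set independent of
  \<open>b\<close>. The count is then measurable in \<open>b\<close>, and sums over moves can be
  exchanged with integrals over \<open>b\<close>.\<close>

lemma card_extensions_eq_nn_integral:
  assumes "finite L"
  shows "of_nat (card (monotone_extensions E L b \<inter> A)) =
    (\<integral>\<^sup>+f. indicator (Mon E \<inter> A) (translate f b) \<partial>count_space {f. \<forall>v. v \<notin> L \<longrightarrow> f v = 0})"
proof -
  let ?FL = "{f :: 'v \<Rightarrow> int. \<forall>v. v \<notin> L \<longrightarrow> f v = 0}"
  let ?S = "{f \<in> ?FL. translate f b \<in> Mon E \<inter> A}"
  have bij: "bij_betw (\<lambda>f. translate f b) ?S (monotone_extensions E L b \<inter> A)"
  proof (rule bij_betw_byWitness[where f' = "\<lambda>h v. h v - b v"])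
    show "(\<lambda>f. translate f b) ` ?S \<subseteq> monotone_extensions E L b \<inter> A"
      by (auto simp: monotone_extensions_def translate_def)
    show "(\<lambda>h v. h v - b v) ` (monotone_extensions E L b \<inter> A) \<subseteq> ?S"
      by (auto simp: monotone_extensions_def translate_def)
  qed (auto simp: translate_def)
  have fin: "finite ?S"
    using bij_betw_finite[OF bij] finite_extensions[OF assms] by auto
  have "(\<integral>\<^sup>+f. indicator (Mon E \<inter> A) (translate f b) \<partial>count_space ?FL) =
      (\<integral>\<^sup>+f. indicator ?S f \<partial>count_space ?FL)"
    by (intro nn_integral_cong) (auto simp: indicator_def)
  also have "\<dots> = emeasure (count_space ?FL) ?S"
    by (intro nn_integral_indicator) auto
  also have "\<dots> = of_nat (card ?S)"
    using fin by (intro emeasure_count_space_finite) auto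
  finally show ?thesis using bij_betw_same_card[OF bij] by simp
qed

lemma measurable_card_extensions:
  assumes "finite L" and [measurable]: "A \<in> sets height_space"
  shows "(\<lambda>b. of_nat (card (monotone_extensions E L b \<inter> A)) :: ennreal) \<in> borel_measurable height_space"
proof -
  let ?FL = "{f :: 'v \<Rightarrow> int. \<forall>v. v \<notin> L \<longrightarrow> f v = 0}"
  have count: "countable ?FL" by (rule countable_finitely_supported[OF assms(1)])
  interpret FL: sigma_finite_measure "count_space ?FL"
    by (rule sigma_finite_measure_count_space_countable[OF count])
  have "(\<lambda>x. indicator (Mon E \<inter> A) (translate (snd x) (fst x)) :: ennreal)
      \<in> borel_measurable (height_space \<Otimes>\<^sub>M count_space ?FL)"
    by (rule measurable_compose_countable'[where f = "\<lambda>f x. indicator (Mon E \<inter> A) (translate f (fst x))"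
          and g = snd, OF _ _ count]) measurable
  then have "(\<lambda>b. \<integral>\<^sup>+f. indicator (Mon E \<inter> A) (translate f b) \<partial>count_space ?FL)
      \<in> borel_measurable height_space"
    by (intro FL.borel_measurable_nn_integral) (simp add: case_prod_beta')
  then show ?thesis
    by (simp add: card_extensions_eq_nn_integral[OF assms(1)])
qed

text \<open>Detailed balance: the uniform average is a sum over moves \<open>f\<close> supported in
  \<open>L\<close>, invariance reverses each move under the integral, and the reversed moves
  available at a monotone \<open>b\<close> number exactly \<open>N b\<close>.\<close>

lemma gibbs_measureI:
  assumes prob: "prob_space \<nu>" and sets: "sets \<nu> = sets height_space" and mon: "AE h in \<nu>. h \<in> Mon E"
    and inv: "\<And>f. finite {v. f v \<noteq> 0} \<Longrightarrow> translation_invariant \<nu> f"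
  shows "gibbs_measure E \<nu>"
  unfolding gibbs_measure_def
proof (intro conjI allI impI ballI prob sets mon)
  fix L :: "'v set" and A :: "('v \<Rightarrow> int) set"
  assume L: "finite L" and A [measurable]: "A \<in> sets height_space"
  note sets [measurable_cong]
  let ?FL = "{f :: 'v \<Rightarrow> int. \<forall>v. v \<notin> L \<longrightarrow> f v = 0}"
  have count: "countable ?FL" by (rule countable_finitely_supported[OF L])
  have finsupp: "finite {v. f v \<noteq> 0}" if "f \<in> ?FL" for f
    by (rule finite_subset[OF _ L]) (use that in auto)
  define N where "N b = (of_nat (card (monotone_extensions E L b)) :: ennreal)" for b
  have N [measurable]: "N \<in> borel_measurable height_space"
    using measurable_card_extensions[OF L, of UNIV] by (simp add: N_def[abs_def] sets.top[of height_space, simplified])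
  have Npos: "N b \<noteq> 0" "N b < top" if "b \<in> Mon E" for b
    using card_extensions_pos[OF L that] by (auto simp: N_def of_nat_less_top)
  have Ntr: "N (translate f b) = N b" if "f \<in> ?FL" for f b
    unfolding N_def using that by (subst extensions_translate) auto
  \<comment> \<open>The number \<open>N\<close> of extensions is the same at both ends of a move in
    \<open>L\<close>, so the weight may be evaluated after the move.\<close>
  define G where "G h = indicator A h / N h" for h
  have [measurable]: "G \<in> borel_measurable height_space"
    unfolding G_def by measurable
  have "(\<integral>\<^sup>+b\<in>Mon E. emeasure (spec E L b) A \<partial>\<nu>) =
      (\<integral>\<^sup>+b. \<integral>\<^sup>+f. G (translate f b) * indicator (mon_pair f) b \<partial>count_space ?FL \<partial>\<nu>)"
  proof (rule nn_integral_cong)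
    fix b
    show "emeasure (spec E L b) A * indicator (Mon E) b =
        (\<integral>\<^sup>+f. G (translate f b) * indicator (mon_pair f) b \<partial>count_space ?FL)"
    proof (cases "b \<in> Mon E")
      case True
      have "emeasure (spec E L b) A = of_nat (card (monotone_extensions E L b \<inter> A)) / N b"
        by (simp add: emeasure_spec[OF L True] N_def)
      also have "\<dots> = (\<integral>\<^sup>+f. indicator (Mon E \<inter> A) (translate f b) / N b \<partial>count_space ?FL)"
        by (simp add: card_extensions_eq_nn_integral[OF L] nn_integral_divide)
      also have "\<dots> = (\<integral>\<^sup>+f. G (translate f b) * indicator (mon_pair f) b \<partial>count_space ?FL)"
        by (intro nn_integral_cong)
          (use True in \<open>auto simp: G_def Ntr mon_pair_def indicator_def\<close>)
      finally show ?thesis using True by simp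
    qed (simp add: mon_pair_def)
  qed
  also have "\<dots> = (\<integral>\<^sup>+f. \<integral>\<^sup>+b. G (translate f b) * indicator (mon_pair f) b \<partial>\<nu> \<partial>count_space ?FL)"
    by (intro nn_integral_count_space_nn_integral count) measurable
  also have "\<dots> = (\<integral>\<^sup>+f. \<integral>\<^sup>+b. G b * indicator (mon_pair (\<lambda>v. - f v)) b \<partial>\<nu> \<partial>count_space ?FL)"
  proof (rule nn_integral_cong)
    fix f assume "f \<in> space (count_space ?FL)"
    then have "translation_invariant \<nu> f" using inv finsupp by simp
    moreover have "G \<in> borel_measurable \<nu>" by measurable
    ultimately show "(\<integral>\<^sup>+b. G (translate f b) * indicator (mon_pair f) b \<partial>\<nu>) =
        (\<integral>\<^sup>+b. G b * indicator (mon_pair (\<lambda>v. - f v)) b \<partial>\<nu>)"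
      unfolding translation_invariant_def by blast
  qed
  also have "\<dots> = (\<integral>\<^sup>+b. \<integral>\<^sup>+f. G b * indicator (mon_pair (\<lambda>v. - f v)) b \<partial>count_space ?FL \<partial>\<nu>)"
    by (intro nn_integral_count_space_nn_integral[symmetric] count) measurable
  also have "\<dots> = (\<integral>\<^sup>+b. indicator A b \<partial>\<nu>)"
  proof (rule nn_integral_cong_AE)
    have "(\<integral>\<^sup>+f. G b * indicator (mon_pair (\<lambda>v. - f v)) b \<partial>count_space ?FL) = indicator A b"
      if b: "b \<in> Mon E" for b
    proof -
      \<comment> \<open>Negation permutes \<open>?FL\<close>, so there are \<open>N b\<close>
        reversed moves at \<open>b\<close>; this cancels the denominator of
        \<open>G b\<close>.\<close>
      have bij: "bij_betw (\<lambda>f v. - f v) ?FL ?FL"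
        by (rule bij_betw_byWitness[where f' = "\<lambda>f v. - f v"]) auto
      have "(\<integral>\<^sup>+f. indicator (mon_pair (\<lambda>v. - f v)) b \<partial>count_space ?FL) =
          (\<integral>\<^sup>+f. indicator (mon_pair f) b \<partial>count_space ?FL)"
        using nn_integral_bij_count_space[OF bij, of "\<lambda>f. indicator (mon_pair f) b"] .
      also have "\<dots> = (\<integral>\<^sup>+f. indicator (Mon E \<inter> UNIV) (translate f b) \<partial>count_space ?FL)"
        by (intro nn_integral_cong) (use b in \<open>auto simp: mon_pair_def indicator_def\<close>)
      also have "\<dots> = N b"
        using card_extensions_eq_nn_integral[OF L, of b UNIV] by (simp add: N_def)
      finally show ?thesis
        using Npos[OF b] by (simp add: nn_integral_cmult nn_integral_divide G_def ennreal_divide_times)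
    qed
    then show "AE b in \<nu>. (\<integral>\<^sup>+f. G b * indicator (mon_pair (\<lambda>v. - f v)) b \<partial>count_space ?FL) = indicator A b"
      using mon by (auto elim!: eventually_mono)
  qed
  also have "\<dots> = emeasure \<nu> A" by (rule nn_integral_indicator) (simp add: sets)
  finally show "(\<integral>\<^sup>+b\<in>Mon E. emeasure (spec E L b) A \<partial>\<nu>) = emeasure \<nu> A" .
qed

text \<open>The move is a bijection between the parts of the two events in each set of extensions,
  which carries the uniform distribution.\<close>

lemma gibbs_measure_translate:
  assumes gibbs: "gibbs_measure E \<nu>" and fin: "finite {v. f v \<noteq> 0}" and A [measurable]: "A \<in> sets height_space"
  shows "emeasure \<nu> {h \<in> mon_pair f. translate f h \<in> A} = emeasure \<nu> (A \<inter> mon_pair (\<lambda>v. - f v))"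
proof -
  let ?L = "{v. f v \<noteq> 0}" and ?B = "{h \<in> mon_pair f. translate f h \<in> A}" and ?B' = "A \<inter> mon_pair (\<lambda>v. - f v)"
  have B: "?B \<in> sets height_space"
  proof -
    have "?B = mon_pair f \<inter> (translate f -` A \<inter> space height_space)" by auto
    also have "\<dots> \<in> sets height_space" by measurable
    finally show ?thesis .
  qed
  have B': "?B' \<in> sets height_space" by measurable
  have "card (monotone_extensions E ?L b \<inter> ?B) = card (monotone_extensions E ?L b \<inter> ?B')" for b
  proof (rule bij_betw_same_card)
    have tr: "translate f h \<in> monotone_extensions E ?L b" if "h \<in> monotone_extensions E ?L b" "h \<in> mon_pair f" for h
      using that by (auto simp: monotone_extensions_def mon_pair_def translate_def)
    have trn: "translate (\<lambda>v. - f v) h \<in> monotone_extensions E ?L b"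
      if "h \<in> monotone_extensions E ?L b" "h \<in> mon_pair (\<lambda>v. - f v)" for h
      using that by (auto simp: monotone_extensions_def mon_pair_def translate_def)
    show "bij_betw (translate f) (monotone_extensions E ?L b \<inter> ?B) (monotone_extensions E ?L b \<inter> ?B')"
      by (rule bij_betw_byWitness[where f' = "translate (\<lambda>v. - f v)"])
        (use tr trn in \<open>auto simp: mon_pair_def\<close>)
  qed
  then have eq: "(\<integral>\<^sup>+b\<in>Mon E. emeasure (spec E ?L b) ?B \<partial>\<nu>) = (\<integral>\<^sup>+b\<in>Mon E. emeasure (spec E ?L b) ?B' \<partial>\<nu>)"
    by (intro nn_integral_cong) (auto simp: emeasure_spec[OF fin] indicator_def)
  have "(\<integral>\<^sup>+b\<in>Mon E. emeasure (spec E ?L b) C \<partial>\<nu>) = emeasure \<nu> C" if "C \<in> sets height_space" for C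
    using gibbs fin that by (simp add: gibbs_measure_def)
  from this[OF B] this[OF B'] eq show ?thesis by simp
qed

end

section \<open>Flow measures are invariant under raising a single vertex\<close>

context flow_tree
begin

text \<open>
  Both sides have \<open>flux v\<close> added, and this is cancelled if finite; otherwise both sides are infinite.
\<close>

lemma sum_flux_shift:
  assumes "\<And>u. m1 u + of_bool (p u = v) = m2 u + of_bool (u = v)"
  shows "(\<Sum>\<^sub>\<infinity>u. of_nat (m1 u) * flux u) = (\<Sum>\<^sub>\<infinity>u. of_nat (m2 u) * flux u)"
proof -
  have sm: "f summable_on A" for f :: "'v \<Rightarrow> ennreal" and A
    by (rule nonneg_summable_on_complete) simp
  \<comment> \<open>This is the flow condition at \<open>v\<close>.\<close>
  have c: "(\<Sum>\<^sub>\<infinity>u. of_nat (of_bool (p u = v)) * flux u) = flux v"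
    unfolding flux_children[of v] by (rule infsum_cong_neutral) auto
  have s: "(\<Sum>\<^sub>\<infinity>u. of_nat (of_bool (u = v)) * flux u) = flux v"
  proof -
    have "(\<Sum>\<^sub>\<infinity>u. of_nat (of_bool (u = v)) * flux u) = (\<Sum>\<^sub>\<infinity>u\<in>{v}. flux u)"
      by (rule infsum_cong_neutral) auto
    then show ?thesis by simp
  qed
  \<comment> \<open>As \<open>v\<close> is not its own child, the assumption forces each indicator
    into the opposite exponent; hence both totals are at least \<open>flux v\<close>.\<close>
  have m1: "m1 u \<ge> of_bool (u = v)" and m2: "m2 u \<ge> of_bool (p u = v)" for u
    using assms[of u] parent_neq[of v] by (cases "u = v"; cases "p u = v"; force)+
  have "(\<Sum>\<^sub>\<infinity>u. of_nat (of_bool (u = v)) * flux u) \<le> (\<Sum>\<^sub>\<infinity>u. of_nat (m1 u) * flux u)"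
    by (intro infsum_mono sm mult_right_mono of_nat_mono m1) simp
  then have l1: "flux v \<le> (\<Sum>\<^sub>\<infinity>u. of_nat (m1 u) * flux u)" unfolding s .
  have "(\<Sum>\<^sub>\<infinity>u. of_nat (of_bool (p u = v)) * flux u) \<le> (\<Sum>\<^sub>\<infinity>u. of_nat (m2 u) * flux u)"
    by (intro infsum_mono sm mult_right_mono of_nat_mono m2) simp
  then have l2: "flux v \<le> (\<Sum>\<^sub>\<infinity>u. of_nat (m2 u) * flux u)" unfolding c .
  have "(\<Sum>\<^sub>\<infinity>u. of_nat (m1 u) * flux u) + flux v
      = (\<Sum>\<^sub>\<infinity>u. of_nat (m1 u) * flux u + of_nat (of_bool (p u = v)) * flux u)"
    by (subst c[symmetric], rule infsum_add[symmetric]) (rule sm)+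
  also have "\<dots> = (\<Sum>\<^sub>\<infinity>u. of_nat (m2 u) * flux u + of_nat (of_bool (u = v)) * flux u)"
    unfolding distrib_right[symmetric] of_nat_add[symmetric] assms ..
  also have "\<dots> = (\<Sum>\<^sub>\<infinity>u. of_nat (m2 u) * flux u) + flux v"
    by (subst infsum_add[OF sm sm]) (simp only: s)
  finally show ?thesis
    using l1 l2 by (cases "flux v = top") (auto simp: top_unique)
qed

text \<open>Both sides are integrals against finite measures, compared on
  \<open>gradient_generator\<close>. There both events are lower bounds on all gradients, and
  \<open>sum_flux_shift\<close> equates the two exponents.\<close>

lemma translation_invariant_single: "translation_invariant \<mu> (indicator {v})"
proof -
  let ?f = "indicator {v} :: 'v \<Rightarrow> int"
  let ?nf = "\<lambda>u. - ?f u"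
  let ?M1 = "distr (density \<mu> (indicator (mon_pair ?f))) gradient_space (translate ?f)"
  let ?M2 = "density \<mu> (indicator (mon_pair ?nf))"
  have grad_f: "grad u ?f = of_bool (p u = v) - of_bool (u = v)" for u
    by (simp add: grad_indicator)
  have e1: "emeasure ?M1 X = emeasure \<mu> {h \<in> mon_pair ?f. translate ?f h \<in> X}"
    if [measurable]: "X \<in> sets gradient_space" for X
  proof -
    have vim: "translate ?f -` X \<in> events"
      using measurable_sets[OF measurable_translate_gradient that, of ?f] by (simp add: sets_mu)
    have "emeasure ?M1 X = (\<integral>\<^sup>+h. indicator (mon_pair ?f) h * indicator (translate ?f -` X \<inter> space \<mu>) h \<partial>\<mu>)"
      using vim by (subst emeasure_distr) (auto intro!: emeasure_density)
    also have "\<dots> = (\<integral>\<^sup>+h. indicator (mon_pair ?f \<inter> (translate ?f -` X \<inter> space \<mu>)) h \<partial>\<mu>)"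
      by (simp add: indicator_inter_arith)
    also have "\<dots> = emeasure \<mu> (mon_pair ?f \<inter> (translate ?f -` X \<inter> space \<mu>))"
      using vim by (intro nn_integral_indicator) auto
    also have "mon_pair ?f \<inter> (translate ?f -` X \<inter> space \<mu>) = {h \<in> mon_pair ?f. translate ?f h \<in> X}"
      by auto
    finally show ?thesis .
  qed
  have e2: "emeasure ?M2 X = emeasure \<mu> {h \<in> mon_pair ?nf. h \<in> X}"
    if [measurable]: "X \<in> sets gradient_space" for X
  proof -
    have "emeasure ?M2 X = (\<integral>\<^sup>+h. indicator (mon_pair ?nf) h * indicator X h \<partial>\<mu>)"
      by (intro emeasure_density) auto
    also have "\<dots> = (\<integral>\<^sup>+h. indicator (mon_pair ?nf \<inter> X) h \<partial>\<mu>)"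
      by (simp add: indicator_inter_arith)
    also have "\<dots> = emeasure \<mu> (mon_pair ?nf \<inter> X)"
      by (rule nn_integral_indicator) measurable
    also have "mon_pair ?nf \<inter> X = {h \<in> mon_pair ?nf. h \<in> X}" by auto
    finally show ?thesis .
  qed
  have "?M1 = ?M2"
  proof (rule measure_eqI_generator_eq[OF Int_stable_gradient_generator, where \<Omega> = UNIV and A = "\<lambda>_. UNIV"])
    fix X assume X: "X \<in> gradient_generator"
    then have sX: "X \<in> sets gradient_space"
      unfolding sets_gradient_space_generator by (rule sigma_sets.Basic)
    from X obtain F k where Xe: "X = {h. \<forall>u\<in>F. k u \<le> grad u h}" by (rule gradient_generatorE)
    \<comment> \<open>Off \<open>F\<close> the bound 0 stands for monotonicity alone.
      \<open>m1\<close> bounds \<open>h\<close> so that \<open>h\<close> is monotone and its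
      translate obeys \<open>k'\<close>; \<open>m2\<close> bounds it so that \<open>h\<close> obeys
      \<open>k'\<close> and the reverse translate is monotone.\<close>
    define k' where "k' u = (if u \<in> F then nat (k u) else 0)" for u
    define m1 where "m1 u = nat (int (k' u) - grad u ?f)" for u
    define m2 where "m2 u = nat (max (int (k' u)) (grad u ?f))" for u
    have k': "int (k' u) \<le> x \<longleftrightarrow> 0 \<le> x \<and> (u \<in> F \<longrightarrow> k u \<le> x)" for u x
      by (auto simp: k'_def)
    have s1: "{h \<in> mon_pair ?f. translate ?f h \<in> X} = {h. \<forall>u. int (m1 u) \<le> grad u h}"
    proof -
      have "int (m1 u) \<le> grad u h \<longleftrightarrow> 0 \<le> grad u h \<and> 0 \<le> grad u (translate ?f h)
          \<and> (u \<in> F \<longrightarrow> k u \<le> grad u (translate ?f h))" for u h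
        using k'[of u "grad u (translate ?f h)"]
        unfolding m1_def translate_def grad_add by linarith
      then show ?thesis by (auto simp: mon_pair_def Mon_iff Xe)
    qed
    have s2: "{h \<in> mon_pair ?nf. h \<in> X} = {h. \<forall>u. int (m2 u) \<le> grad u h}"
    proof -
      have "grad u (translate ?nf h) = grad u h - grad u ?f" for u h
        by (simp add: translate_def grad_def)
      then have "int (m2 u) \<le> grad u h \<longleftrightarrow> 0 \<le> grad u h \<and> 0 \<le> grad u (translate ?nf h)
          \<and> (u \<in> F \<longrightarrow> k u \<le> grad u h)" for u h
        using k'[of u "grad u h"] unfolding m2_def by (simp add: max_def) linarith
      then show ?thesis by (auto simp: mon_pair_def Mon_iff Xe)
    qed
    have "(\<Sum>\<^sub>\<infinity>u. of_nat (m1 u) * flux u) = (\<Sum>\<^sub>\<infinity>u. of_nat (m2 u) * flux u)"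
    proof (rule sum_flux_shift)
      show "m1 u + of_bool (p u = v) = m2 u + of_bool (u = v)" for u
        using parent_neq[of v] unfolding m1_def m2_def grad_f
        by (cases "u = v"; cases "p u = v") auto
    qed
    then show "emeasure ?M1 X = emeasure ?M2 X"
      unfolding e1[OF sX] e2[OF sX] s1 s2 emeasure_eq_measure prob_all_grad_ge by simp
  next
    show "range (\<lambda>_. UNIV) \<subseteq> gradient_generator"
      using gradient_generatorI[of "{}"] by auto
    have "emeasure ?M1 UNIV \<le> 1"
      using e1[OF sets.top[of gradient_space, simplified]] by (simp add: emeasure_le_1)
    then show "emeasure ?M1 UNIV \<noteq> \<infinity>" by (auto simp: top_unique)
  qed (simp_all add: sets_mu sets_gradient_space_generator)
  show ?thesis
    unfolding translation_invariant_def
  proof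
    fix F :: "('v \<Rightarrow> int) \<Rightarrow> ennreal" assume F [measurable]: "F \<in> borel_measurable \<mu>"
    have "(\<integral>\<^sup>+h\<in>mon_pair ?f. F (translate ?f h) \<partial>\<mu>) = (\<integral>\<^sup>+h. F h \<partial>?M1)"
      by (subst nn_integral_distr) (auto simp: nn_integral_density mult.commute)
    also have "\<dots> = (\<integral>\<^sup>+h\<in>mon_pair ?nf. F h \<partial>\<mu>)"
      unfolding \<open>?M1 = ?M2\<close> by (subst nn_integral_density) (auto simp: mult.commute)
    finally show "(\<integral>\<^sup>+h\<in>mon_pair ?f. F (translate ?f h) \<partial>\<mu>) = (\<integral>\<^sup>+h\<in>mon_pair ?nf. F h \<partial>\<mu>)" .
  qed
qed

lemma translation_invariant_mu: "finite {v. f v \<noteq> 0} \<Longrightarrow> translation_invariant \<mu> f"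
  by (rule translation_invariant_finite_support[OF sets_mu translation_invariant_single])

end

section \<open>Pinning the height at infinity\<close>

text \<open>The constant cancels on generators, and the property passes to complements and countable
  unions. As \<open>h\<close> is fixed, \<open>c\<close> may depend on it, which allows subtracting
  a random height.\<close>

lemma gradient_set_shift:
  assumes "A \<in> sets gradient_space"
  shows "(\<lambda>v. h v - c) \<in> A \<longleftrightarrow> h \<in> A"
  using assms unfolding sets_gradient_space
proof (induction rule: sigma_sets.induct)
  case (Basic A)
  then obtain y z B where "A = {h. h y - h z \<in> B}" by blast
  then show ?case by simp
qed auto

lemma Mon_shift: "(\<lambda>v. h v - c) \<in> Mon E \<longleftrightarrow> h \<in> Mon E"
  by (auto simp: Mon_def)

context flow_tree
begin

lemma prob_grad_ge_1: "prob {h. 1 \<le> grad v h} = exp_neg (flux v)"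
  using prob_grad_ge[of 1 v] by simp

text \<open>Strict ancestors are listed without repetition by the iterates from the first on, hence
  \<open>Suc n\<close>. Both conditions amount to boundedness of the finite partial sums.\<close>

lemma infsum_ancestors_finite_iff:
  "(\<Sum>\<^sub>\<infinity>y\<in>ancestors E x. ennreal (exp_neg (\<phi> (y, p y)))) < \<infinity> \<longleftrightarrow>
    summable (\<lambda>n. exp_neg (flux ((p ^^ Suc n) x)))" (is "?S < \<infinity> \<longleftrightarrow> summable ?q")
proof -
  have "inj (\<lambda>n. (p ^^ Suc n) x)"
    by (auto intro!: injI simp: funpow_parent_eq_iff simp del: funpow.simps)
  then have S: "?S = (\<Sum>\<^sub>\<infinity>n. ennreal (?q n))"
    unfolding ancestors_eq by (subst infsum_reindex) (auto simp: flux_def o_def)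
  have sm: "(\<lambda>n. ennreal (?q n)) summable_on A" for A
    by (rule nonneg_summable_on_complete) simp
  show ?thesis
  proof
    assume fin: "?S < \<infinity>"
    show "summable ?q"
    proof (rule summableI_nonneg_bounded)
      fix n
      have "ennreal (\<Sum>i<n. ?q i) = (\<Sum>i<n. ennreal (?q i))"
        by (simp add: sum_ennreal)
      also have "\<dots> = (\<Sum>\<^sub>\<infinity>i\<in>{..<n}. ennreal (?q i))" by simp
      also have "\<dots> \<le> ?S"
        unfolding S by (rule infsum_mono_neutral[OF sm sm]) auto
      finally show "(\<Sum>i<n. ?q i) \<le> enn2real ?S"
        using fin by (cases ?S) (auto simp: sum_nonneg)
    qed simp
  next
    assume q: "summable ?q"
    have "?S \<le> ennreal (suminf ?q)"
      unfolding S
    proof (rule infsum_le_finite_sums[OF sm])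
      fix F :: "nat set" assume "finite F"
      then have "sum ?q F \<le> suminf ?q" by (intro sum_le_suminf q) auto
      then show "(\<Sum>n\<in>F. ennreal (?q n)) \<le> ennreal (suminf ?q)"
        by (simp add: sum_ennreal ennreal_leI)
    qed
    also have "\<dots> < \<infinity>" by simp
    finally show "?S < \<infinity>" .
  qed
qed

text \<open>By Borel-Cantelli only finitely many gradients along the line are at least 1; by
  monotonicity the remaining ones vanish.\<close>

lemma AE_eventually_const:
  assumes "summable (\<lambda>n. exp_neg (flux ((p ^^ Suc n) x)))"
  shows "AE h in \<mu>. \<exists>c. eventually (\<lambda>n. h ((p ^^ n) x) = c) sequentially"
proof -
  let ?A = "\<lambda>n. {h. 1 \<le> grad ((p ^^ Suc n) x) h}"
  have "AE h in \<mu>. eventually (\<lambda>n. h \<in> space \<mu> - ?A n) sequentially"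
  proof (rule borel_cantelli_AE1)
    fix n
    have "{h \<in> space gradient_space. 1 \<le> grad ((p ^^ Suc n) x) h} \<in> sets gradient_space"
      by measurable
    then show "?A n \<in> sets \<mu>" by (simp add: sets_mu)
  qed (use assms in \<open>simp_all add: prob_grad_ge_1 less_top[symmetric] del: funpow.simps\<close>)
  with AE_Mon show ?thesis
  proof eventually_elim
    case (elim h)
    from elim(2) obtain N where N: "\<And>n. N \<le> n \<Longrightarrow> grad ((p ^^ Suc n) x) h \<le> 0"
      by (force simp: eventually_sequentially)
    have step: "h ((p ^^ Suc (Suc n)) x) = h ((p ^^ Suc n) x)" if "N \<le> n" for n
      using N[OF that] elim(1) by (auto simp: Mon_iff grad_def dest: spec[of _ "(p ^^ Suc n) x"] intro: antisym)
    have const: "h ((p ^^ Suc n) x) = h ((p ^^ Suc N) x)" if "N \<le> n" for n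
      using that by (induction n rule: dec_induct) (simp_all only: step)
    have "h ((p ^^ n) x) = h ((p ^^ Suc N) x)" if "Suc N \<le> n" for n
    proof -
      from that obtain m where "n = Suc m" "N \<le> m" by (cases n) auto
      with const[of m] show ?thesis by (simp only:)
    qed
    then show ?case unfolding eventually_sequentially by blast
  qed
qed

lemma localised_if_summable:
  assumes summ: "summable (\<lambda>n. exp_neg (flux ((p ^^ Suc n) x)))"
  shows "localised E \<mu>"
proof -
  define L where "L h = h x + \<lfloor>lim (\<lambda>n. real_of_int (h ((p ^^ n) x) - h x))\<rfloor>" for h :: "'v \<Rightarrow> int"
  \<comment> \<open>\<open>lim\<close> is junk unless the heights above \<open>x\<close> converge, which happens almost surely.\<close>
  define T where "T h v = h v - L h" for h :: "'v \<Rightarrow> int" and v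
  have L_eq: "L h = c" if "eventually (\<lambda>n. h ((p ^^ n) x) = c) sequentially" for h c
  proof -
    have "(\<lambda>n. real_of_int (h ((p ^^ n) x) - h x)) \<longlonglongrightarrow> real_of_int (c - h x)"
      by (rule tendsto_eventually) (use that in \<open>auto elim: eventually_mono\<close>)
    then have "lim (\<lambda>n. real_of_int (h ((p ^^ n) x) - h x)) = real_of_int (c - h x)"
      by (rule limI)
    then show ?thesis by (simp add: L_def del: of_int_diff)
  qed
  have T: "T \<in> measurable \<mu> height_space"
  proof (rule measurable_to_height_space)
    fix v
    \<comment> \<open>In \<open>T h v\<close> the summand \<open>h x\<close> of \<open>L h\<close>
      leaves only height differences, which are measurable in \<open>gradient_space\<close>.\<close>
    have "(\<lambda>h. \<lfloor>lim (\<lambda>n. real_of_int (h ((p ^^ n) x) - h x))\<rfloor>) \<in> measurable gradient_space (count_space UNIV)"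
    proof (rule measurable_compose[OF _ measurable_real_floor], rule borel_measurable_lim_metric)
      fix n
      show "(\<lambda>h. real_of_int (h ((p ^^ n) x) - h x)) \<in> borel_measurable gradient_space"
        by (rule measurable_compose[OF measurable_gradient_diff]) simp
    qed
    then have "(\<lambda>h. (h v - h x) - \<lfloor>lim (\<lambda>n. real_of_int (h ((p ^^ n) x) - h x))\<rfloor>)
        \<in> measurable gradient_space (count_space UNIV)"
      by (rule measurable_int_binop[where op = "(-)", OF measurable_gradient_diff])
    then show "(\<lambda>h. T h v) \<in> measurable \<mu> (count_space UNIV)"
      unfolding T_def L_def by (simp add: measurable_cong_sets[OF sets_mu refl] diff_diff_eq)
  qed
  have T_shift: "T h = (\<lambda>v. h v - L h)" for h by (simp add: T_def fun_eq_iff)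
  have T_Mon: "T h \<in> Mon E \<longleftrightarrow> h \<in> Mon E" for h
    unfolding T_shift by (rule Mon_shift)
  have T_mon_pair: "T h \<in> mon_pair f \<longleftrightarrow> h \<in> mon_pair f" for h f
  proof -
    have "translate f (T h) = (\<lambda>v. translate f h v - L h)"
      by (simp add: T_def translate_def fun_eq_iff)
    then show ?thesis by (simp add: mon_pair_def T_Mon Mon_shift)
  qed
  have T_translate: "AE h in \<mu>. T (translate f h) = translate f (T h)" if fin: "finite {v. f v \<noteq> 0}" for f
    using AE_eventually_const[OF summ]
  proof eventually_elim
    case (elim h)
    then obtain c where c: "eventually (\<lambda>n. h ((p ^^ n) x) = c) sequentially" by blast
    \<comment> \<open>The line is injective, so it meets the finite support of \<open>f\<close>
      finitely often and the eventual height is unchanged.\<close>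
    have "finite ((\<lambda>n. (p ^^ n) x) -` {v. f v \<noteq> 0})"
      by (rule finite_vimageI[OF fin inj_funpow_parent])
    then have "eventually (\<lambda>n. f ((p ^^ n) x) = 0) sequentially"
      by (simp add: eventually_cofinite cofinite_eq_sequentially[symmetric] vimage_def)
    with c have "eventually (\<lambda>n. translate f h ((p ^^ n) x) = c) sequentially"
      by eventually_elim (simp add: translate_def)
    with c show ?case by (simp add: T_def L_eq translate_def fun_eq_iff)
  qed
  define \<nu> where "\<nu> = distr \<mu> height_space T"
  have sets_nu: "sets \<nu> = sets height_space" by (simp add: \<nu>_def)
  have "gibbs_measure E \<nu>"
  proof (rule gibbs_measureI[OF _ sets_nu])
    show "prob_space \<nu>" unfolding \<nu>_def by (rule prob_space_distr[OF T])
    show "AE h in \<nu>. h \<in> Mon E"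
      unfolding \<nu>_def using AE_Mon by (subst AE_distr_iff[OF T]) (auto simp: T_Mon)
    fix f :: "'v \<Rightarrow> int" assume fin: "finite {v. f v \<noteq> 0}"
    show "translation_invariant \<nu> f"
      unfolding translation_invariant_def
    proof
      fix F :: "('v \<Rightarrow> int) \<Rightarrow> ennreal" assume "F \<in> borel_measurable \<nu>"
      then have F [measurable]: "F \<in> borel_measurable height_space"
        by (simp add: measurable_cong_sets[OF sets_nu refl])
      have FT: "(\<lambda>h. F (T h)) \<in> borel_measurable \<mu>" by (rule measurable_compose[OF T F])
      have "(\<integral>\<^sup>+h\<in>mon_pair f. F (translate f h) \<partial>\<nu>) =
          (\<integral>\<^sup>+h. F (translate f (T h)) * indicator (mon_pair f) (T h) \<partial>\<mu>)"
        unfolding \<nu>_def by (rule nn_integral_distr[OF T]) measurable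
      also have "\<dots> = (\<integral>\<^sup>+h\<in>mon_pair f. F (T (translate f h)) \<partial>\<mu>)"
        by (rule nn_integral_cong_AE)
          (use T_translate[OF fin] in \<open>auto simp: indicator_def T_mon_pair elim!: eventually_mono\<close>)
      also have "\<dots> = (\<integral>\<^sup>+h\<in>mon_pair (\<lambda>v. - f v). F (T h) \<partial>\<mu>)"
        using translation_invariant_mu[OF fin] FT unfolding translation_invariant_def by (rule bspec)
      also have "\<dots> = (\<integral>\<^sup>+h. F (T h) * indicator (mon_pair (\<lambda>v. - f v)) (T h) \<partial>\<mu>)"
        by (simp add: indicator_def T_mon_pair)
      also have "\<dots> = (\<integral>\<^sup>+h\<in>mon_pair (\<lambda>v. - f v). F h \<partial>\<nu>)"
        unfolding \<nu>_def by (rule nn_integral_distr[OF T, symmetric]) measurable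
      finally show "(\<integral>\<^sup>+h\<in>mon_pair f. F (translate f h) \<partial>\<nu>) = (\<integral>\<^sup>+h\<in>mon_pair (\<lambda>v. - f v). F h \<partial>\<nu>)" .
    qed
  qed
  moreover have "restr_to_subalg \<nu> gradient_space = \<mu>"
  proof (rule measure_eqI)
    have sub: "subalgebra \<nu> gradient_space"
      using gradient_subset_height by (simp add: subalgebra_def \<nu>_def)
    show "sets (restr_to_subalg \<nu> gradient_space) = sets \<mu>"
      by (simp add: sets_restr_to_subalg[OF sub] sets_mu)
    fix A assume "A \<in> sets (restr_to_subalg \<nu> gradient_space)"
    then have A: "A \<in> sets gradient_space" by (simp add: sets_restr_to_subalg[OF sub])
    have "emeasure (restr_to_subalg \<nu> gradient_space) A = emeasure \<nu> A"
      by (rule emeasure_restr_to_subalg[OF sub A])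
    also have "\<dots> = emeasure \<mu> (T -` A \<inter> space \<mu>)"
      unfolding \<nu>_def using A gradient_subset_height by (intro emeasure_distr[OF T]) auto
    \<comment> \<open>\<open>T\<close> subtracts a constant from each \<open>h\<close>, which
      gradient events do not see.\<close>
    also have "T -` A \<inter> space \<mu> = A"
      using gradient_set_shift[OF A] by (auto simp: T_shift)
    finally show "emeasure (restr_to_subalg \<nu> gradient_space) A = emeasure \<mu> A" .
  qed
  ultimately show ?thesis unfolding localised_def by blast
qed

end

section \<open>Delocalisation\<close>

text \<open>Second moment method: \<open>Z\<close> is the centred number of events that occur, and
  the left side is the absolute expectation of \<open>Z\<close> on \<open>C\<close>. Near
  independence of pairs bounds the second moment of \<open>Z\<close>.\<close>

lemma (in prob_space) sum_prob_concentration: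
  fixes q :: "nat \<Rightarrow> real"
  assumes A [measurable]: "\<And>j. A j \<in> events" and q: "\<And>j. prob (A j) = q j"
    and pair: "\<And>i j. i < j \<Longrightarrow> prob (A i \<inter> A j) \<le> (1 + \<delta>) * (q i * q j)"
    and \<delta>: "0 \<le> \<delta>" and C [measurable]: "C \<in> events"
  defines "w \<equiv> \<lambda>n. \<Sum>j<n. q j"
  shows "\<bar>(\<Sum>j<n. prob (A j \<inter> C)) - w n * prob C\<bar> \<le> sqrt (w n + \<delta> * (w n)\<^sup>2)"
proof -
  let ?w = "w n"
  define Z where "Z x = (\<Sum>j<n. indicat_real (A j) x) - ?w" for x
  have Z_C: "Z x * indicator C x = (\<Sum>j<n. indicat_real (A j \<inter> C) x) - ?w * indicator C x" for x
    by (simp add: Z_def left_diff_distrib sum_distrib_right indicator_inter_arith)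
  have Z_sq: "(Z x)\<^sup>2 = (\<Sum>i<n. \<Sum>j<n. indicat_real (A i \<inter> A j) x)
      - 2 * ?w * (\<Sum>j<n. indicat_real (A j) x) + ?w\<^sup>2" for x
  proof -
    have "(\<Sum>i<n. \<Sum>j<n. indicat_real (A i \<inter> A j) x) =
        (\<Sum>j<n. indicat_real (A j) x) * (\<Sum>j<n. indicat_real (A j) x)"
      unfolding sum_product indicator_inter_arith ..
    then show ?thesis unfolding Z_def by (simp only: power2_eq_square) (simp add: algebra_simps)
  qed
  have int_sq: "integrable M (\<lambda>x. (Z x)\<^sup>2)"
    unfolding Z_sq by (intro Bochner_Integration.integrable_add Bochner_Integration.integrable_diff
        integrable_mult_right Bochner_Integration.integrable_sum) (auto simp: emeasure_eq_measure)
  have int_C: "integrable M (\<lambda>x. Z x * indicator C x)"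
    unfolding Z_C by (intro Bochner_Integration.integrable_diff integrable_mult_right
        Bochner_Integration.integrable_sum) (auto simp: emeasure_eq_measure)
  have Z_C_sq: "(Z x * indicator C x)\<^sup>2 = (Z x)\<^sup>2 * indicator C x" for x
    by (simp add: indicator_def)
  have int_C_sq: "integrable M (\<lambda>x. (Z x * indicator C x)\<^sup>2)"
    unfolding Z_C_sq by (rule integrable_real_mult_indicator[OF C int_sq])
  have "expectation (\<lambda>x. Z x * indicator C x) = (\<Sum>j<n. prob (A j \<inter> C)) - ?w * prob C"
    unfolding Z_C by (subst Bochner_Integration.integral_diff)
      (auto simp: emeasure_eq_measure Bochner_Integration.integral_sum)
  \<comment> \<open>Nonnegativity of the variance serves as the Cauchy-Schwarz inequality.\<close>
  moreover have "(expectation (\<lambda>x. Z x * indicator C x))\<^sup>2 \<le> expectation (\<lambda>x. (Z x * indicator C x)\<^sup>2)"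
    using variance_eq[OF int_C int_C_sq] variance_positive[of "\<lambda>x. Z x * indicator C x"] by simp
  moreover have "expectation (\<lambda>x. (Z x * indicator C x)\<^sup>2) \<le> expectation (\<lambda>x. (Z x)\<^sup>2)"
    by (intro integral_mono int_C_sq int_sq) (simp add: Z_C_sq indicator_def)
  moreover have "expectation (\<lambda>x. (Z x)\<^sup>2) \<le> ?w + \<delta> * ?w\<^sup>2"
  proof -
    have q0: "0 \<le> q j" for j using q[of j] measure_nonneg[of M "A j"] by simp
    \<comment> \<open>The extra diagonal term makes one bound serve all pairs; summed up, it
      contributes \<open>?w\<close>.\<close>
    have pair': "prob (A i \<inter> A j) \<le> (1 + \<delta>) * (q i * q j) + (if i = j then q i else 0)" for i j
    proof -
      consider "i < j" | "j < i" | "i = j" by linarith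
      then show ?thesis
        using pair[of i j] pair[of j i] q[of i] q0 \<delta> by cases (auto simp: Int_commute mult.commute)
    qed
    have "expectation (\<lambda>x. (Z x)\<^sup>2) = (\<Sum>i<n. \<Sum>j<n. prob (A i \<inter> A j)) - 2 * ?w * (\<Sum>j<n. q j) + ?w\<^sup>2"
      unfolding Z_sq
      by (subst Bochner_Integration.integral_add, (simp add: emeasure_eq_measure)+)+
        (simp add: q prob_space)
    also have "\<dots> = (\<Sum>i<n. \<Sum>j<n. prob (A i \<inter> A j)) - ?w\<^sup>2"
      by (simp add: w_def power2_eq_square)
    also have "(\<Sum>i<n. \<Sum>j<n. prob (A i \<inter> A j))
        \<le> (\<Sum>i<n. \<Sum>j<n. (1 + \<delta>) * (q i * q j) + (if i = j then q i else 0))"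
      by (intro sum_mono pair')
    also have "\<dots> = (1 + \<delta>) * ?w\<^sup>2 + ?w"
      by (simp add: sum.distrib sum_distrib_left[symmetric] sum_distrib_right[symmetric]
          w_def power2_eq_square)
    finally show ?thesis by (simp add: algebra_simps)
  qed
  ultimately show ?thesis by (intro real_le_rsqrt) simp
qed

section \<open>Raising a finite set with a top vertex\<close>

context countable_up_tree
begin

text \<open>Monotonicity is included so that these sets are exactly the domains of moves that raise
  or lower a set by one.\<close>

definition steep :: "'v set \<Rightarrow> ('v \<Rightarrow> int) set" where
  "steep A = {h \<in> Mon E. \<forall>v\<in>A. 1 \<le> grad v h}"

definition rim :: "'v set \<Rightarrow> 'v set" where
  "rim S = {v. v \<notin> S \<and> p v \<in> S}"

text \<open>A finite subtree with top vertex \<open>y\<close>: only the edge above \<open>y\<close>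
  leaves it upwards, so raising it lowers the gradient at \<open>y\<close> alone.\<close>

definition rooted :: "'v set \<Rightarrow> 'v \<Rightarrow> bool" where
  "rooted S y \<longleftrightarrow> finite S \<and> y \<in> S \<and> p y \<notin> S \<and> (\<forall>v\<in>S. v \<noteq> y \<longrightarrow> p v \<in> S)"

lemma steep_in_gradient [measurable]: "steep A \<in> sets gradient_space"
proof -
  have "steep A = Mon E \<inter> {h \<in> space gradient_space. \<forall>v\<in>A. 1 \<le> grad v h}"
    by (auto simp: steep_def)
  also have "\<dots> \<in> sets gradient_space" by measurable
  finally show ?thesis .
qed

lemma steep_Un: "steep A \<inter> steep B = steep (A \<union> B)"
  by (auto simp: steep_def)

lemma mon_pair_indicator:
  assumes "rooted S y"
  shows "mon_pair (indicator S) = steep {y}"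
proof -
  have "0 \<le> grad v h + grad v (indicator S) \<longleftrightarrow> (v = y \<longrightarrow> 1 \<le> grad v h)" if "0 \<le> grad v h" for v h
    using assms that by (auto simp: rooted_def grad_indicator of_bool_def)
  then show ?thesis
    by (auto simp: mon_pair_def steep_def Mon_iff translate_def grad_add)
qed

lemma mon_pair_uminus_indicator: "mon_pair (\<lambda>v. - indicator S v) = steep (rim S)"
proof -
  have "0 \<le> grad v h - grad v (indicator S) \<longleftrightarrow> (v \<in> rim S \<longrightarrow> 1 \<le> grad v h)" if "0 \<le> grad v h" for v h
    using that by (auto simp: rim_def grad_indicator of_bool_def)
  moreover have "grad v (translate (\<lambda>v. - indicator S v) h) = grad v h - grad v (indicator S)" for v h
    by (simp add: translate_def grad_def)
  ultimately show ?thesis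
    by (auto simp: mon_pair_def steep_def Mon_iff)
qed

end

section \<open>Flow through rims and almost independent events\<close>

context flow_tree
begin

definition total_flux :: "'v set \<Rightarrow> ennreal" where
  "total_flux A = (\<Sum>\<^sub>\<infinity>v\<in>A. flux v)"

lemma summable_flux: "(f :: 'v \<Rightarrow> ennreal) summable_on A"
  by (rule nonneg_summable_on_complete) simp

lemma total_flux_eq: "total_flux A = (\<Sum>\<^sub>\<infinity>v. of_nat (of_bool (v \<in> A)) * flux v)"
  unfolding total_flux_def by (rule infsum_cong_neutral) auto

lemma total_flux_mono: "A \<subseteq> B \<Longrightarrow> total_flux A \<le> total_flux B"
  unfolding total_flux_def by (rule infsum_mono_neutral[OF summable_flux summable_flux]) auto

lemma total_flux_Un_Int: "total_flux (A \<union> B) + total_flux (A \<inter> B) = total_flux A + total_flux B"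
  unfolding total_flux_eq infsum_add[OF summable_flux summable_flux, symmetric]
  by (rule infsum_cong) (auto simp: of_bool_def)

lemma prob_steep: "prob (steep A) = exp_neg (total_flux A)"
proof -
  have "int (of_bool (v \<in> A)) \<le> grad v h \<longleftrightarrow> 0 \<le> grad v h \<and> (v \<in> A \<longrightarrow> 1 \<le> grad v h)" for v h
    by auto
  then have "steep A = {h. \<forall>v. int (of_bool (v \<in> A)) \<le> grad v h}"
    by (auto simp: steep_def Mon_iff)
  then show ?thesis by (simp only: prob_all_grad_ge total_flux_eq)
qed

text \<open>Conservation of flow for \<open>S\<close>, read off from invariance: the domains of
  raising and of lowering \<open>S\<close> have equal probability, and \<open>exp_neg\<close> is
  injective. Infinite flows are thereby included.\<close>

lemma total_flux_rim:
  assumes "rooted S y"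
  shows "total_flux (rim S) = flux y"
proof -
  have fin: "finite {v. indicator S v \<noteq> (0 :: int)}"
    using assms by (simp add: rooted_def indicator_def)
  have "(\<integral>\<^sup>+h\<in>mon_pair (indicator S). 1 \<partial>\<mu>) = (\<integral>\<^sup>+h\<in>mon_pair (\<lambda>v. - indicator S v). 1 \<partial>\<mu>)"
    using translation_invariant_mu[OF fin] unfolding translation_invariant_def
    by (rule bspec[where x = "\<lambda>_. 1"]) simp
  then have "prob (steep {y}) = prob (steep (rim S))"
    unfolding mon_pair_indicator[OF assms] mon_pair_uminus_indicator
    by (simp add: emeasure_eq_measure sets_mu)
  then show ?thesis
    unfolding prob_steep exp_neg_inj by (simp add: total_flux_def)
qed

text \<open>Finite partial sums approximate a finite total. Finiteness is a premise inside the
  conclusion so that one choice function can serve every \<open>R\<close>.\<close>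

lemma finite_subset_small_remainder:
  assumes "0 < \<epsilon>"
  shows "\<exists>F. finite F \<and> F \<subseteq> R \<and> (total_flux R < \<infinity> \<longrightarrow> total_flux (R - F) \<le> ennreal \<epsilon>)"
proof (cases "total_flux R < \<infinity>")
  case True
  have "(sum flux \<longlongrightarrow> total_flux R) (finite_subsets_at_top R)"
    using has_sum_infsum[OF summable_flux[of flux R]] by (simp add: has_sum_def total_flux_def)
  \<comment> \<open>For total 0 the truncated difference is again 0 and the strict inequality fails;
    the empty set then serves.\<close>
  moreover have "total_flux R - ennreal \<epsilon> < total_flux R \<or> total_flux R = 0"
    using True assms by (cases "total_flux R") (auto simp: ennreal_minus intro!: ennreal_lessI)
  ultimately have "\<exists>F. finite F \<and> F \<subseteq> R \<and> total_flux R \<le> sum flux F + ennreal \<epsilon>"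
  proof (elim disjE)
    assume "(sum flux \<longlongrightarrow> total_flux R) (finite_subsets_at_top R)"
      "total_flux R - ennreal \<epsilon> < total_flux R"
    then have "eventually (\<lambda>F. total_flux R - ennreal \<epsilon> < sum flux F) (finite_subsets_at_top R)"
      by (rule order_tendstoD)
    then obtain F where "finite F" "F \<subseteq> R" "total_flux R - ennreal \<epsilon> < sum flux F"
      unfolding eventually_finite_subsets_at_top by blast
    then show ?thesis
      by (intro exI[of _ F]) (auto simp: ennreal_minus_le_iff add.commute dest!: less_imp_le)
  qed (intro exI[of _ "{}"], simp)
  then obtain F where F: "finite F" "F \<subseteq> R" "total_flux R \<le> sum flux F + ennreal \<epsilon>" by blast
  have "total_flux R = total_flux F + total_flux (R - F)"
    using total_flux_Un_Int[of F "R - F"] F(2) by (simp add: Un_absorb1 total_flux_def)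
  moreover have "total_flux F = sum flux F" using F(1) by (simp add: total_flux_def)
  moreover have "sum flux F \<noteq> top"
    using True calculation by (auto simp: top_unique)
  ultimately have "total_flux (R - F) \<le> ennreal \<epsilon>"
    using F(3) by (simp add: ennreal_add_left_cancel_le)
  with F show ?thesis by blast
qed auto

text \<open>
  A vertex may have infinitely many children, so rims of finite sets cannot be made disjoint. But
  \<open>S (Suc i)\<close> can swallow all of the rim of \<open>S i\<close> up to a part carrying little flow, so the
  events are almost pairwise independent.
\<close>

lemma steep_rim_sequence:
  assumes "0 < \<delta>"
  obtains S where
    "\<And>j. rooted (S j) ((p ^^ j) x)" "\<And>j. x \<in> S j"
    "\<And>i j. i < j \<Longrightarrow> prob (steep (rim (S i)) \<inter> steep (rim (S j)))
       \<le> (1 + \<delta>) * (exp_neg (flux ((p ^^ i) x)) * exp_neg (flux ((p ^^ j) x)))"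
proof -
  \<comment> \<open>A common part of two rims with flow at most \<epsilon> then costs a factor of at
    most \<open>1 + \<delta>\<close>.\<close>
  define \<epsilon> where "\<epsilon> = ln (1 + \<delta>)"
  have \<epsilon>: "0 < \<epsilon>" "exp \<epsilon> = 1 + \<delta>" using assms by (auto simp: \<epsilon>_def)
  obtain F where F: "\<And>R. finite (F R)" "\<And>R. F R \<subseteq> R"
    "\<And>R. total_flux R < \<infinity> \<Longrightarrow> total_flux (R - F R) \<le> ennreal \<epsilon>"
    using finite_subset_small_remainder[OF \<epsilon>(1)] by metis
  define S where "S = rec_nat {x} (\<lambda>j S. insert ((p ^^ Suc j) x) (S \<union> F (rim S)))"
  have S0: "S 0 = {x}" and SS: "S (Suc j) = insert ((p ^^ Suc j) x) (S j \<union> F (rim (S j)))" for j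
    by (simp_all add: S_def)
  have fin: "finite (S j)" for j by (induction j) (simp_all add: S0 SS F)
  have top: "(p ^^ j) x \<in> S j" for j by (cases j) (simp_all add: S0 SS)
  have par: "p v \<in> S j" if "v \<in> S j" "v \<noteq> (p ^^ j) x" for v j
    using that
  proof (induction j arbitrary: v)
    case (Suc j)
    have "p v \<in> S (Suc j)" if "v \<in> S j"
      using Suc.IH[OF that] by (cases "v = (p ^^ j) x") (auto simp: SS)
    moreover have "p v \<in> S (Suc j)" if "v \<in> F (rim (S j))"
      using that F(2)[of "rim (S j)"] by (auto simp: SS rim_def)
    ultimately show ?case using Suc.prems by (auto simp: SS)
  qed (simp add: S0)
  \<comment> \<open>All of \<open>S j\<close> lies at or below its top vertex, so the parent of the
    top is outside.\<close>
  have desc: "\<exists>n. (p ^^ n) v = (p ^^ j) x" if "v \<in> S j" for v j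
    using that
  proof (induction j arbitrary: v)
    case 0
    then show ?case by (intro exI[of _ 0]) (simp add: S0)
  next
    case (Suc j)
    have S: "\<exists>n. (p ^^ n) v = (p ^^ Suc j) x" if v: "v \<in> S j" for v
    proof -
      obtain n where "(p ^^ n) v = (p ^^ j) x" using Suc.IH[OF v] by blast
      then show ?thesis by (intro exI[of _ "Suc n"]) simp
    qed
    have "\<exists>n. (p ^^ n) v = (p ^^ Suc j) x" if "v \<in> F (rim (S j))"
    proof -
      have "p v \<in> S j" using that F(2)[of "rim (S j)"] by (auto simp: rim_def)
      then obtain n where "(p ^^ n) (p v) = (p ^^ Suc j) x" using S by blast
      then show ?thesis by (intro exI[of _ "Suc n"]) (simp add: funpow_swap1)
    qed
    moreover have "\<exists>n. (p ^^ n) v = (p ^^ Suc j) x" if "v = (p ^^ Suc j) x"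
      using that by (intro exI[of _ 0]) simp
    ultimately show ?case using Suc.prems S unfolding SS by blast
  qed
  have rooted: "rooted (S j) ((p ^^ j) x)" for j
  proof -
    have "p ((p ^^ j) x) \<notin> S j"
    proof
      assume "p ((p ^^ j) x) \<in> S j"
      then obtain n where "(p ^^ n) (p ((p ^^ j) x)) = (p ^^ j) x" using desc by blast
      then have "(p ^^ Suc n) ((p ^^ j) x) = (p ^^ j) x" by (simp add: funpow_swap1)
      then show False using funpow_parent_neq by blast
    qed
    with fin top par show ?thesis by (simp add: rooted_def)
  qed
  have mono: "S i \<subseteq> S j" if "i \<le> j" for i j
    using that by (induction rule: dec_induct) (auto simp: SS)
  have x: "x \<in> S j" for j using mono[of 0 j] by (auto simp: S0)
  have "prob (steep (rim (S i)) \<inter> steep (rim (S j)))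
      \<le> (1 + \<delta>) * (exp_neg (flux ((p ^^ i) x)) * exp_neg (flux ((p ^^ j) x)))" if ij: "i < j" for i j
  proof -
    let ?R = "rim (S i)" and ?R' = "rim (S j)"
    note flux = total_flux_rim[OF rooted]
    have prob: "prob (steep ?R \<inter> steep ?R') = exp_neg (total_flux (?R \<union> ?R'))"
      by (simp add: steep_Un prob_steep)
    show ?thesis
    proof (cases "total_flux ?R < \<infinity>")
      case True
      \<comment> \<open>\<open>F ?R\<close> is contained in \<open>S (Suc i)\<close>, hence in
        \<open>S j\<close>, and so misses the rim of \<open>S j\<close>.\<close>
      have "?R \<inter> ?R' \<subseteq> ?R - F ?R"
        using mono[of "Suc i" j] ij by (auto simp: SS rim_def)
      then have "total_flux (?R \<inter> ?R') \<le> ennreal \<epsilon>"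
        using total_flux_mono F(3)[OF True] order_trans by blast
      then have "exp (- \<epsilon>) \<le> exp_neg (total_flux (?R \<inter> ?R'))"
        using exp_neg_antimono exp_neg_ennreal[of \<epsilon>] \<epsilon>(1) by fastforce
      then have "exp_neg (total_flux (?R \<union> ?R')) * exp (- \<epsilon>) \<le>
          exp_neg (total_flux (?R \<union> ?R')) * exp_neg (total_flux (?R \<inter> ?R'))"
        by (rule mult_left_mono) simp
      \<comment> \<open>Union and intersection together carry both rim flows, which equal the flows
        out of the two top vertices.\<close>
      also have "\<dots> = exp_neg (flux ((p ^^ i) x)) * exp_neg (flux ((p ^^ j) x))"
        by (simp add: exp_neg_add[symmetric] total_flux_Un_Int flux)
      finally show ?thesis
        unfolding prob using \<epsilon>(2) assms by (simp add: exp_minus field_simps)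
    next
      case False
      then have "total_flux ?R = \<infinity>" by (simp add: less_top[symmetric])
      then have "total_flux (?R \<union> ?R') = \<infinity>"
        using total_flux_mono[of ?R "?R \<union> ?R'"] by (simp add: top_unique)
      then show ?thesis unfolding prob using assms by (simp add: exp_neg_def)
    qed
  qed
  with rooted x that show thesis by blast
qed

lemma summable_if_gibbs:
  assumes gibbs: "gibbs_measure E \<nu>" and restr: "restr_to_subalg \<nu> gradient_space = \<mu>"
  shows "summable (\<lambda>n. exp_neg (flux ((p ^^ n) x)))"
proof (rule ccontr)
  let ?y = "\<lambda>j. (p ^^ j) x" and ?q = "\<lambda>j. exp_neg (flux ((p ^^ j) x))"
  assume div: "\<not> summable ?q"
  interpret \<nu>: prob_space \<nu> using gibbs by (simp add: gibbs_measure_def)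
  have sets_nu [measurable_cong]: "sets \<nu> = sets height_space"
    using gibbs by (simp add: gibbs_measure_def)
  have space_nu [simp]: "space \<nu> = UNIV" using sets_eq_imp_space_eq[OF sets_nu] by simp
  have sub: "subalgebra \<nu> gradient_space"
    using gradient_subset_height by (simp add: subalgebra_def sets_nu)
  \<comment> \<open>Probabilities of gradient events come from \<mu>; the heights at
    \<open>x\<close> are tied to them by the Gibbs property of \<nu>.\<close>
  have agree: "\<nu>.prob A = prob A" if "A \<in> sets gradient_space" for A
    using emeasure_restr_to_subalg[OF sub that] by (simp add: restr measure_def)
  have steep_height: "steep A \<in> sets height_space" for A
    using gradient_subset_height steep_in_gradient by blast
  have level: "{h. h x = a} \<in> sets height_space" for a
  proof -
    have "(\<lambda>h. h x) -` {a} \<inter> space height_space \<in> sets height_space" by measurable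
    then show ?thesis by (simp add: vimage_def)
  qed
  have step: "\<nu>.prob {h. h x = a - 1} = \<nu>.prob {h. h x = a}" for a
  proof (rule ccontr)
    let ?C = "{h. h x = a - 1}" and ?C' = "{h. h x = a}"
    define d where "d = \<bar>\<nu>.prob ?C - \<nu>.prob ?C'\<bar>"
    assume "\<nu>.prob ?C \<noteq> \<nu>.prob ?C'"
    then have d: "0 < d" by (simp add: d_def)
    \<comment> \<open>With this value the term \<open>4 * \<delta> * (w n)\<^sup>2\<close> below is
      half of \<open>(w n * d)\<^sup>2\<close> and can be absorbed.\<close>
    define \<delta> where "\<delta> = d\<^sup>2 / 8"
    have \<delta>: "0 < \<delta>" using d by (simp add: \<delta>_def)
    obtain S where S: "\<And>j. rooted (S j) (?y j)" "\<And>j. x \<in> S j"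
      "\<And>i j. i < j \<Longrightarrow> prob (steep (rim (S i)) \<inter> steep (rim (S j))) \<le> (1 + \<delta>) * (?q i * ?q j)"
      using steep_rim_sequence[OF \<delta>, of x] by blast
    define w where "w n = (\<Sum>j<n. ?q j)" for n
    have w0: "0 \<le> w n" for n by (simp add: w_def sum_nonneg)
    have up: "\<bar>(\<Sum>j<n. \<nu>.prob (steep {?y j} \<inter> ?C)) - w n * \<nu>.prob ?C\<bar> \<le> sqrt (w n + \<delta> * (w n)\<^sup>2)" for n
      unfolding w_def
    proof (rule \<nu>.sum_prob_concentration)
      show "\<nu>.prob (steep {?y j}) = ?q j" for j
        by (simp add: agree prob_steep total_flux_def)
      show "\<nu>.prob (steep {?y i} \<inter> steep {?y j}) \<le> (1 + \<delta>) * (?q i * ?q j)" if "i < j" for i j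
      proof -
        \<comment> \<open>The edges above distinct ancestors are distinct, so here independence is
          exact.\<close>
        have "\<nu>.prob (steep {?y i} \<inter> steep {?y j}) = ?q i * ?q j"
          using that
          by (simp add: steep_Un agree prob_steep total_flux_def exp_neg_add funpow_parent_eq_iff)
        also have "\<dots> \<le> (1 + \<delta>) * (?q i * ?q j)"
          using \<delta> by (simp add: distrib_right)
        finally show ?thesis .
      qed
    qed (use \<delta> level in \<open>auto simp: steep_height sets_nu\<close>)
    have down: "\<bar>(\<Sum>j<n. \<nu>.prob (steep (rim (S j)) \<inter> ?C')) - w n * \<nu>.prob ?C'\<bar> \<le> sqrt (w n + \<delta> * (w n)\<^sup>2)" for n
      unfolding w_def
    proof (rule \<nu>.sum_prob_concentration)
      show "\<nu>.prob (steep (rim (S j))) = ?q j" for j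
        by (simp add: agree prob_steep total_flux_rim[OF S(1)])
      show "\<nu>.prob (steep (rim (S i)) \<inter> steep (rim (S j))) \<le> (1 + \<delta>) * (?q i * ?q j)" if "i < j" for i j
        using S(3)[OF that] by (simp add: agree steep_Un)
    qed (use \<delta> level in \<open>auto simp: steep_height sets_nu\<close>)
    \<comment> \<open>As \<open>S j\<close> contains \<open>x\<close>, raising it takes the height
      at \<open>x\<close> from \<open>a - 1\<close> to \<open>a\<close>.\<close>
    have move: "\<nu>.prob (steep {?y j} \<inter> ?C) = \<nu>.prob (steep (rim (S j)) \<inter> ?C')" for j
    proof -
      have fin: "finite {v. indicator (S j) v \<noteq> (0 :: int)}"
        using S(1)[of j] by (simp add: rooted_def indicator_def)
      have "{h \<in> steep {?y j}. translate (indicator (S j)) h \<in> ?C'} = steep {?y j} \<inter> ?C"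
        using S(2)[of j] by (auto simp: translate_def)
      then show ?thesis
        using gibbs_measure_translate[OF gibbs fin level[of a]]
        by (simp add: mon_pair_indicator[OF S(1)] mon_pair_uminus_indicator measure_def Int_commute)
    qed
    have "w n \<le> 8 / d\<^sup>2" for n
    proof -
      \<comment> \<open>By \<open>move\<close> the two sums coincide, so both approximate the same
        number; a gap of order \<open>w n\<close> is possible only while \<open>w n\<close> stays
        bounded.\<close>
      have "w n * d = \<bar>w n * \<nu>.prob ?C - w n * \<nu>.prob ?C'\<bar>"
        using w0[of n] by (simp add: d_def right_diff_distrib[symmetric] abs_mult)
      also have "\<dots> \<le> 2 * sqrt (w n + \<delta> * (w n)\<^sup>2)"
        using up[of n] down[of n] by (simp add: move)
      finally have "(w n * d)\<^sup>2 \<le> (2 * sqrt (w n + \<delta> * (w n)\<^sup>2))\<^sup>2"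
        using w0 d by (intro power_mono) auto
      also have "\<dots> = 4 * w n + d\<^sup>2 / 2 * (w n)\<^sup>2"
        using w0[of n] \<delta> by (simp add: power_mult_distrib \<delta>_def)
      finally have "w n * (w n * d\<^sup>2) \<le> w n * 8"
        by (simp add: power2_eq_square algebra_simps)
      then have "w n = 0 \<or> w n * d\<^sup>2 \<le> 8"
        using w0[of n] by (auto simp: mult_le_cancel_left)
      then show ?thesis using d by (auto simp: field_simps)
    qed
    then have "summable ?q" unfolding w_def by (intro summableI_nonneg_bounded) auto
    with div show False ..
  qed
  \<comment> \<open>All heights at \<open>x\<close> carry the same mass \<open>c\<close>. Any
    \<open>n\<close> of them have total mass at most 1, so \<open>c = 0\<close>, and countably many
    null events cannot fill the space.\<close>
  define c where "c = \<nu>.prob {h. h x = 0}"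
  have const: "\<nu>.prob {h. h x = a} = c" for a
  proof (induction a rule: int_induct[where k = 0])
    case (step1 i)
    then show ?case using step[of "i + 1"] by simp
  next
    case (step2 i)
    then show ?case using step[of i] by simp
  qed (simp add: c_def)
  have "real n * c \<le> 1" for n
  proof -
    have "real n * c = (\<Sum>i<n. \<nu>.prob {h. h x = int i})" by (simp add: const)
    also have "\<dots> = \<nu>.prob (\<Union>i<n. {h. h x = int i})"
      by (rule \<nu>.finite_measure_finite_Union[symmetric])
        (auto simp: sets_nu level disjoint_family_on_def)
    also have "\<dots> \<le> 1" by simp
    finally show ?thesis .
  qed
  moreover have "0 \<le> c" by (simp add: c_def)
  ultimately have "c = 0"
    by (metis antisym_conv1 reals_Archimedean3 not_le)
  then have "{h. h x = a} \<in> null_sets \<nu>" for a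
    using const[of a] level by (auto simp: null_sets_def sets_nu \<nu>.emeasure_eq_measure)
  then have "(\<Union>a. {h. h x = a}) \<in> null_sets \<nu>" by (rule null_sets_UN)
  moreover have "(\<Union>a. {h :: 'v \<Rightarrow> int. h x = a}) = space \<nu>" by auto
  ultimately show False using \<nu>.emeasure_space_1 by (simp add: null_sets_def)
qed

end

theorem theorem2p12:
  fixes E :: "'v::countable rel"
    and \<phi> :: "'v \<times> 'v \<Rightarrow> ennreal"
    and \<mu> :: "('v \<Rightarrow> int) measure"
  assumes "directed_tree E"
    and "flow E \<phi>"
    and "flow_measure E \<phi> \<mu>"
  shows "localised E \<mu> \<longleftrightarrow>
    (\<exists>x. (\<Sum>\<^sub>\<infinity>y\<in>ancestors E x. ennreal (exp_neg (\<phi> (y, parent E y)))) < \<infinity>)"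
proof -
  interpret flow_tree E \<phi> \<mu>
    using assms by unfold_locales
  show ?thesis
    unfolding infsum_ancestors_finite_iff
  proof
    assume "localised E \<mu>"
    then obtain \<nu> where "gibbs_measure E \<nu>" "restr_to_subalg \<nu> gradient_space = \<mu>"
      unfolding localised_def by blast
    \<comment> \<open>In this direction the series converges at every vertex, so an arbitrary one is
      taken; dropping the term of the vertex itself leaves its strict ancestors.\<close>
    then have "summable (\<lambda>n. exp_neg (flux ((p ^^ n) undefined)))"
      by (rule summable_if_gibbs)
    then show "\<exists>x. summable (\<lambda>n. exp_neg (flux ((p ^^ Suc n) x)))"
      by (subst (asm) summable_Suc_iff[symmetric]) blast
  qed (use localised_if_summable in blast)
qed

end
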